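(* Let $\nu$ be a Borel probability measure on $\mathbb{T}$ which is absolutely continuous with respect to the Lebesgue probability measure on $\mathbb{T}$. Let $\alpha$ be an irrational number. Then $\nu$ is representable at $\alpha$, that is, there is a good set $S\subset\mathbb{N}$ such that $\mu_{S,\alpha}=\nu$.
   Context: $\mathbb{N}=\{1,2,3,\dots\}$, $\mathbb{T}=\mathbb{R}/\mathbb{Z}$ and $e(\beta)=e^{2\pi i\beta}$. A good set $S\subset\mathbb{N}$ is an infinite set of positive integers which, when listed in increasing order as $s_1<s_2<\dots$, has the property that $\lim_{N\to\infty}\frac1N\sum_{n=1}^N e(s_n\beta)$ exists for every real number $\beta$. For a good set $S$ and every $\beta\in\mathbb{T}$, the weak limit of probability measures $\mu_{S,\beta}:=\lim_{N\to\infty}\frac1N\sum_{n=1}^N\delta_{s_n\beta}$ on $\mathbb{T}$ exists (with $s_n\beta$ taken mod $1$). *)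

theory Defs
  imports "HOL-Probability.Probability"
begin

definition circle_rel :: "real \<Rightarrow> real \<Rightarrow> bool" where
  "circle_rel x y \<longleftrightarrow> x - y \<in> \<int>"

lemma equivp_circle_rel: "equivp circle_rel"
proof (rule equivpI)
  show "reflp circle_rel"
    by (simp add: reflp_def circle_rel_def)
  show "symp circle_rel"
    by (metis sympI circle_rel_def Ints_minus minus_diff_eq)
  show "transp circle_rel"
  proof (rule transpI)
    fix x y z :: real
    assume "circle_rel x y" "circle_rel y z"
    then have "(x - y) + (y - z) \<in> \<int>"
      unfolding circle_rel_def by (rule Ints_add)
    then show "circle_rel x z" by (simp add: circle_rel_def)
  qed
qed

quotient_type circle = real / circle_rel
  morphisms rep_circle to_circle
  by (rule equivp_circle_rel)

lemma to_circle_eq_iff: "to_circle x = to_circle y \<longleftrightarrow> x - y \<in> \<int>"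
  using circle.abs_eq_iff[of x y] by (simp add: circle_rel_def)

text \<open>The circle carries the quotient topology; \<^term>\<open>borel\<close> at this type is then its Borel
  sigma-algebra.\<close>

instantiation circle :: topological_space
begin

definition open_circle :: "circle set \<Rightarrow> bool" where
  "open_circle U \<longleftrightarrow> open (to_circle -` U)"

instance
  by standard (auto simp: open_circle_def vimage_Int vimage_Union)

end

lemma continuous_to_circle: "continuous_on UNIV to_circle"
  by (auto simp: continuous_on_open_vimage open_circle_def)

lemma measurable_to_circle [measurable]: "to_circle \<in> borel \<rightarrow>\<^sub>M borel"
  using continuous_to_circle by (rule borel_measurable_continuous_onI)

definition lebesgue_circle :: "circle measure" where
  "lebesgue_circle = distr (uniform_measure lborel {0..<1}) borel to_circle"

lemma prob_space_lebesgue_circle: "prob_space lebesgue_circle"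
  unfolding lebesgue_circle_def
  by (intro prob_space.prob_space_distr prob_space_uniform_measure) simp_all

definition e :: "real \<Rightarrow> complex" where
  "e \<beta> = exp (2 * of_real pi * \<i> * of_real \<beta>)"

text \<open>\<^term>\<open>enumerate S n\<close> counts from \<open>n = 0\<close>: it is the element written \<open>s\<close> with index
  \<open>n + 1\<close> in a listing that starts at index 1.\<close>

definition good_set :: "nat set \<Rightarrow> bool" where
  "good_set S \<longleftrightarrow> infinite S \<and> 0 \<notin> S \<and>
     (\<forall>\<beta>::real. convergent
        (\<lambda>N. (1 / of_nat N) * (\<Sum>n<N. e (real (enumerate S n) * \<beta>))))"

text \<open>The average of the Dirac measures at the first \<open>N\<close> points, for \<open>N > 0\<close>, written as the image
  of the uniform probability measure on the indices.\<close>

definition empirical_measure :: "nat set \<Rightarrow> real \<Rightarrow> nat \<Rightarrow> circle measure" where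
  "empirical_measure S \<beta> N =
     distr (uniform_count_measure {..<N}) borel (\<lambda>n. to_circle (real (enumerate S n) * \<beta>))"

lemma emeasure_empirical_measure:
  assumes "N > 0" "A \<in> sets borel"
  shows "emeasure (empirical_measure S \<beta> N) A =
           ennreal (1 / real N * (\<Sum>n<N. indicator A (to_circle (real (enumerate S n) * \<beta>))))"
proof -
  let ?f = "\<lambda>n. to_circle (real (enumerate S n) * \<beta>)"
  have "?f \<in> uniform_count_measure {..<N} \<rightarrow>\<^sub>M borel"
    by (simp add: measurable_def sets_uniform_count_measure space_uniform_count_measure)
  then have "emeasure (empirical_measure S \<beta> N) A =
      emeasure (uniform_count_measure {..<N}) (?f -` A \<inter> {..<N})"
    unfolding empirical_measure_def
    by (simp add: emeasure_distr assms space_uniform_count_measure)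
  also have "\<dots> = ennreal (real (card (?f -` A \<inter> {..<N})) / real N)"
    by (subst emeasure_uniform_count_measure) auto
  also have "real (card (?f -` A \<inter> {..<N})) = (\<Sum>n<N. indicator A (?f n))"
    by (simp add: indicator_def sum.If_cases Int_def vimage_def conj_commute)
  finally show ?thesis by simp
qed

definition weak_limit ::
    "(nat \<Rightarrow> 'a::topological_space measure) \<Rightarrow> 'a measure \<Rightarrow> bool" where
  "weak_limit M \<mu> \<longleftrightarrow>
     (\<forall>f::'a \<Rightarrow> real. continuous_on UNIV f \<and> bounded (range f) \<longrightarrow>
        (\<lambda>N. integral\<^sup>L (M N) f) \<longlonglongrightarrow> integral\<^sup>L \<mu> f)"

text \<open>\<open>representable_at \<nu> \<alpha>\<close>: the weak limit of the empirical measures of some good set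
  exists and equals \<open>\<nu>\<close>. It is meant for Borel probability measures \<open>\<nu>\<close>.\<close>

definition representable_at :: "circle measure \<Rightarrow> real \<Rightarrow> bool" where
  "representable_at \<nu> \<alpha> \<longleftrightarrow>
     (\<exists>S. good_set S \<and> weak_limit (empirical_measure S \<alpha>) \<nu>)"

end

theory Submission
  imports Defs
begin

text \<open>Absolute continuity enters through the Riemann-Lebesgue lemma: the Fourier coefficients
  \<open>\<integral> e(j y) d\<nu>(y)\<close> tend to \<open>0\<close> as \<open>\<bar>j\<bar>\<close> grows (\<open>riemann_lebesgue_circle\<close>).

  Let \<open>\<rho>\<^sub>k\<close> be the Fejer mean of order \<open>k\<close> of \<open>\<nu>\<close>. It is a trigonometric polynomial with
  \<open>0 \<le> \<rho>\<^sub>k \<le> k\<close> whose coefficients are those of \<open>\<nu>\<close>, damped by the factors \<open>1 - \<bar>j\<bar> / k\<close>. The set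
  \<open>S\<close> is built from consecutive blocks of integers; on the block with parameter \<open>k\<close> it behaves as a random set
  containing \<open>n\<close> with probability \<open>\<rho>\<^sub>k(n\<alpha>) / k\<close>.

  The heart of the proof is the estimate \<open>fejer_mean_averages\<close> for the sums of
  \<open>\<rho>\<^sub>k(m\<alpha>) e(m\<beta>)\<close> over an interval. Such a sum is a combination of geometric sums with ratios
  \<open>e(j\<alpha> + \<beta>)\<close>, \<open>\<bar>j\<bar> < k\<close>. As \<open>\<alpha>\<close> is irrational, at most one of these ratios is close to \<open>1\<close>, so
  all terms but one add up to an error that depends on \<open>k\<close> but neither on \<open>\<beta>\<close> nor on the interval. If \<open>j\<alpha> + \<beta>\<close>
  is an integer for some \<open>j\<close>, the exceptional term is the one with this \<open>j\<close>, and it is the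
  length of the interval times a number close to a Fourier coefficient of \<open>\<nu>\<close>. Otherwise the exceptional
  coefficient is either at most \<open>\<epsilon>\<close> or one of the finitely many larger ones; the geometric sums that belong
  to the latter are bounded once \<open>\<beta>\<close> is fixed. Hence the mean over long intervals is close
  to a number \<open>c(\<beta>)\<close> that does not depend on \<open>k\<close>, and \<open>c(0) = 1\<close>.

  Two devices turn this into a set. The weights \<open>\<rho>\<^sub>k(n\<alpha>) / k\<close> are rounded to \<open>0\<close> or \<open>1\<close> by a derandomised
  Chernoff bound, with an error that is small uniformly in \<open>\<beta>\<close> (\<open>rounding_intervals\<close>). The
  blocks are then put one after the other, each so long that the error bounds, which grow with
  \<open>k\<close> in an uncontrolled way, are negligible compared with what precedes (\<open>glue_blocks\<close>). The averages of
  \<open>e(s \<beta>)\<close> over \<open>s\<close> in \<open>S\<close> thus converge to \<open>c(\<beta>)\<close> for every \<open>\<beta>\<close>, so \<open>S\<close> is good. For \<open>\<beta> = j\<alpha>\<close> the limit is the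
  Fourier coefficient of \<open>\<nu>\<close>, and since trigonometric polynomials are dense in the continuous
  functions on the circle, this is the required weak convergence (\<open>weak_limit_circleI\<close>).\<close>

section \<open>The exponential map\<close>

lemma e_eq_cis: "e x = cis (2 * pi * x)"
  by (simp add: e_def cis_conv_exp mult_ac)

lemma e_add: "e (x + y) = e x * e y"
  by (simp add: e_eq_cis cis_mult ring_distribs)

lemma e_diff: "e (x - y) = e x * cnj (e y)"
  by (simp add: e_eq_cis cis_mult cis_cnj ring_distribs)

lemma cnj_e: "cnj (e x) = e (- x)"
  by (simp add: e_eq_cis cis_cnj)

lemma e_0 [simp]: "e 0 = 1"
  by (simp add: e_eq_cis)

lemma norm_e [simp]: "norm (e x) = 1"
  by (simp add: e_eq_cis)

lemma e_eq_1_iff: "e x = 1 \<longleftrightarrow> x \<in> \<int>"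
proof -
  have "e x = 1 \<longleftrightarrow> (\<exists>n::int. x = of_int n)"
    unfolding e_def exp_eq_1 by (auto simp: field_simps)
  then show ?thesis by (auto simp: Ints_def)
qed

lemma e_eq_iff: "e x = e y \<longleftrightarrow> x - y \<in> \<int>"
proof -
  have "e x = e y * e (x - y)" by (simp flip: e_add)
  moreover have "e y \<noteq> 0" using norm_e[of y] by (metis norm_zero zero_neq_one)
  ultimately have "e x = e y \<longleftrightarrow> e (x - y) = 1" by auto
  then show ?thesis by (simp add: e_eq_1_iff)
qed

lemma e_of_nat_mult: "e (real m * x) = e x ^ m"
  by (induction m) (simp_all add: ring_distribs e_add)

lemma norm_e_diff_le: "norm (e x - e y) \<le> 2 * pi * \<bar>x - y\<bar>"
proof -
  have "e x - e y = e y * (e (x - y) - 1)"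
    by (simp add: ring_distribs flip: e_add)
  then have "norm (e x - e y) = norm (e (x - y) - 1)"
    by (simp add: norm_mult)
  also have "e (x - y) = exp (\<i> * of_real (2 * pi * (x - y)))"
    by (simp add: e_def mult_ac)
  also have "norm (\<dots> - 1) = 2 * \<bar>sin (pi * (x - y))\<bar>"
    by (subst dist_exp_i_1) simp
  also have "\<dots> \<le> 2 * \<bar>pi * (x - y)\<bar>"
    using abs_sin_x_le_abs_x by (intro mult_left_mono) auto
  finally show ?thesis by (simp add: abs_mult mult_ac)
qed

section \<open>Rounding weights to a set\<close>

lemma exp_le_quadratic:
  fixes y :: real
  assumes "\<bar>y\<bar> \<le> 1"
  shows "exp y \<le> 1 + y + y\<^sup>2"
proof (cases "y \<ge> 0")
  case True
  then show ?thesis using exp_bound assms by auto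
next
  case False
  define t where "t = - y"
  have t: "0 \<le> t" using False by (simp add: t_def)
  have "1 \<le> (1 - t + t\<^sup>2) * (1 + t + t\<^sup>2 / 2)"
  proof -
    have "(1 - t + t\<^sup>2) * (1 + t + t\<^sup>2 / 2) = 1 + (t\<^sup>2 + t ^ 3 + t ^ 4) / 2"
      by (simp add: field_simps power2_eq_square power3_eq_cube power4_eq_xxxx)
    then show ?thesis using t by simp
  qed
  also have "\<dots> \<le> (1 - t + t\<^sup>2) * exp t"
  proof (rule mult_left_mono)
    show "1 + t + t\<^sup>2 / 2 \<le> exp t" by (rule exp_lower_Taylor_quadratic[OF t])
    have "0 \<le> (1 - t)\<^sup>2 + t" using t by simp
    then show "0 \<le> 1 - t + t\<^sup>2" by (simp add: power2_eq_square algebra_simps)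
  qed
  finally have "exp (- t) \<le> 1 - t + t\<^sup>2"
    by (simp add: exp_minus field_simps)
  then show ?thesis by (simp add: t_def)
qed

text \<open>The moment generating function of a centred Bernoulli variable: the linear terms of the quadratic
  bound for \<open>exp\<close> cancel because the variable has mean \<open>0\<close>.\<close>

lemma bernoulli_mgf_le:
  fixes w l :: real
  assumes "0 \<le> w" "w \<le> 1" "\<bar>l\<bar> \<le> 1"
  shows "w * exp (l * (1 - w)) + (1 - w) * exp (l * (0 - w)) \<le> exp (l\<^sup>2)"
proof -
  have "\<bar>l * (1 - w)\<bar> \<le> 1" "\<bar>l * (0 - w)\<bar> \<le> 1"
    using assms by (auto simp: abs_mult intro!: mult_le_one)
  then have "w * exp (l * (1 - w)) + (1 - w) * exp (l * (0 - w)) \<le>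
     w * (1 + l * (1 - w) + (l * (1 - w))\<^sup>2) + (1 - w) * (1 + l * (0 - w) + (l * (0 - w))\<^sup>2)"
    using assms by (intro add_mono mult_left_mono exp_le_quadratic) auto
  also have "\<dots> = 1 + l\<^sup>2 * (w * (1 - w))"
    by (simp add: algebra_simps power2_eq_square)
  also have "\<dots> \<le> 1 + l\<^sup>2"
    using assms mult_le_one[of w "1 - w"] by (simp add: mult_left_le)
  also have "\<dots> \<le> exp (l\<^sup>2)" by (rule exp_ge_add_one_self)
  finally show ?thesis .
qed

text \<open>A derandomised Chernoff bound. If the \<open>x j\<close> were independent with \<open>P (x j) = w j\<close>, the
  expectation of the potential \<open>\<Sum>i\<in>I. exp (l * D i m)\<close>, where \<open>D i m\<close> is the discrepancy on the left-hand
  side below, would grow at most by the factor \<open>exp (l\<^sup>2)\<close> in each step. So one of the two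
  possible values of \<open>x m\<close> lets the potential grow by no more than this factor, and choosing such a value each time gives
  a deterministic sequence for which every single summand is bounded.\<close>

lemma rounding_finite_family:
  fixes f :: "'i \<Rightarrow> nat \<Rightarrow> real" and w :: "nat \<Rightarrow> real"
  assumes I: "finite I" and f: "\<And>i j. i \<in> I \<Longrightarrow> \<bar>f i j\<bar> \<le> 1"
    and w: "\<And>j. 0 \<le> w j" "\<And>j. w j \<le> 1" and l: "0 < l" "l \<le> 1"
  shows "\<exists>x :: nat \<Rightarrow> bool. \<forall>i\<in>I. \<forall>m\<le>n.
           (\<Sum>j<m. (of_bool (x j) - w j) * f i j) \<le> ln (card I) / l + l * m"
proof -
  define D where "D x i m = (\<Sum>j<m. (of_bool (x j) - w j) * f i j)" for x :: "nat \<Rightarrow> bool" and i m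
  define Phi where "Phi x m = (\<Sum>i\<in>I. exp (l * D x i m))" for x m
  have "\<exists>x. \<forall>m\<le>n. Phi x m \<le> card I * exp (l\<^sup>2 * m)"
  proof (induction n)
    case 0
    then show ?case by (simp add: Phi_def D_def)
  next
    case (Suc n)
    then obtain x where x: "\<And>m. m \<le> n \<Longrightarrow> Phi x m \<le> card I * exp (l\<^sup>2 * m)" by blast
    define y where "y b = x(n := b)" for b
    have D_y: "D (y b) i m = D x i m" if "m \<le> n" for b i m
      unfolding D_def y_def using that by (intro sum.cong) auto
    have D_Suc: "D (y b) i (Suc n) = D x i n + (of_bool b - w n) * f i n" for b i
      using D_y[of n b i] by (simp add: D_def y_def)
    have "w n * Phi (y True) (Suc n) + (1 - w n) * Phi (y False) (Suc n) =
      (\<Sum>i\<in>I. exp (l * D x i n) * (w n * exp (l * f i n * (1 - w n))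
           + (1 - w n) * exp (l * f i n * (0 - w n))))"
      unfolding Phi_def D_Suc sum_distrib_left sum.distrib[symmetric]
    proof (intro sum.cong refl)
      fix i
      have *: "exp (l * (D x i n + u * f i n)) = exp (l * D x i n) * exp (l * f i n * u)" for u
      proof -
        have "l * (D x i n + u * f i n) = l * D x i n + l * f i n * u" by (simp add: algebra_simps)
        then show ?thesis by (simp only: exp_add)
      qed
      have factor: "v * (a * p) + (1 - v) * (a * q) = a * (v * p + (1 - v) * q)" for v a p q :: real
        by (simp add: algebra_simps)
      show "w n * exp (l * (D x i n + (of_bool True - w n) * f i n)) +
          (1 - w n) * exp (l * (D x i n + (of_bool False - w n) * f i n)) =
          exp (l * D x i n) * (w n * exp (l * f i n * (1 - w n))
           + (1 - w n) * exp (l * f i n * (0 - w n)))"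
        unfolding of_bool_eq *[of "1 - w n"] *[of "0 - w n"]
        by (rule factor)
    qed
    also have "\<dots> \<le> (\<Sum>i\<in>I. exp (l * D x i n) * exp (l\<^sup>2))"
    proof (intro sum_mono mult_left_mono)
      fix i assume i: "i \<in> I"
      have "w n * exp (l * f i n * (1 - w n)) + (1 - w n) * exp (l * f i n * (0 - w n))
             \<le> exp ((l * f i n)\<^sup>2)"
        using f[OF i] w l by (intro bernoulli_mgf_le) (auto simp: abs_mult intro!: mult_le_one)
      also have "\<dots> \<le> exp (l\<^sup>2)"
        using f[OF i, of n] by (simp add: power_mult_distrib mult_left_le abs_square_le_1)
      finally show "w n * exp (l * f i n * (1 - w n)) + (1 - w n) * exp (l * f i n * (0 - w n))
             \<le> exp (l\<^sup>2)" .
    qed auto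
    also have "\<dots> = Phi x n * exp (l\<^sup>2)" by (simp add: Phi_def sum_distrib_right)
    also have "\<dots> \<le> card I * exp (l\<^sup>2 * n) * exp (l\<^sup>2)" using x[of n] by simp
    also have "\<dots> = card I * exp (l\<^sup>2 * Suc n)" by (simp add: ring_distribs exp_add mult_ac)
    finally have avg: "w n * Phi (y True) (Suc n) + (1 - w n) * Phi (y False) (Suc n)
      \<le> card I * exp (l\<^sup>2 * Suc n)" .
    \<comment> \<open>A weighted mean of the two potentials is small, so one of them is.\<close>
    have "\<exists>b. Phi (y b) (Suc n) \<le> card I * exp (l\<^sup>2 * Suc n)"
    proof (rule ccontr)
      let ?K = "card I * exp (l\<^sup>2 * Suc n)"
      assume "\<not> ?thesis"
      then have "\<And>b. ?K < Phi (y b) (Suc n)" by (auto simp: not_le)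
      then have "\<And>b. 0 < Phi (y b) (Suc n) - ?K" by simp
      then have "0 < w n * (Phi (y True) (Suc n) - ?K) + (1 - w n) * (Phi (y False) (Suc n) - ?K)"
      proof (cases "w n = 0")
        case False
        then show ?thesis
          using w[of n] \<open>\<And>b. 0 < Phi (y b) (Suc n) - ?K\<close>
          by (intro add_pos_nonneg mult_pos_pos mult_nonneg_nonneg less_imp_le[of 0 "Phi (y b) (Suc n) - ?K" for b]) auto
      qed simp
      then show False using avg by (simp add: algebra_simps)
    qed
    then obtain b where b: "Phi (y b) (Suc n) \<le> card I * exp (l\<^sup>2 * Suc n)" ..
    have "Phi (y b) m \<le> card I * exp (l\<^sup>2 * m)" if "m \<le> Suc n" for m
    proof (cases "m = Suc n")
      case False
      then have "m \<le> n" using that by simp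
      then show ?thesis using x[of m] by (simp add: Phi_def D_y)
    qed (use b in simp)
    then show ?case by blast
  qed
  then obtain x where x: "\<And>m. m \<le> n \<Longrightarrow> Phi x m \<le> card I * exp (l\<^sup>2 * m)" by blast
  have "D x i m \<le> ln (card I) / l + l * m" if i: "i \<in> I" and m: "m \<le> n" for i m
  proof -
    have c: "0 < real (card I)" using i I by (auto simp: card_gt_0_iff)
    have "exp (l * D x i m) \<le> Phi x m"
      unfolding Phi_def using I i by (intro member_le_sum) auto
    also have "\<dots> \<le> card I * exp (l\<^sup>2 * m)" using x m by simp
    also have "\<dots> = exp (ln (card I) + l\<^sup>2 * m)" using c by (simp add: exp_add)
    finally have "l * D x i m \<le> ln (card I) + l\<^sup>2 * m" by simp
    then show ?thesis using l by (simp add: field_simps power2_eq_square)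
  qed
  then show ?thesis unfolding D_def by blast
qed

lemma ln_le_linear_eventually:
  fixes K c :: real
  assumes "c > 0" "K > 0"
  shows "\<exists>H::nat>0. ln (K * real H) \<le> c * real H"
proof -
  have "((\<lambda>H::nat. ln (real H) / real H) \<longlonglongrightarrow> 0)"
    using lim_ln_over_n by simp
  moreover have "((\<lambda>H::nat. ln K / real H) \<longlonglongrightarrow> 0)"
    by (rule lim_const_over_n)
  ultimately have "(\<lambda>H::nat. ln K / real H + ln (real H) / real H) \<longlonglongrightarrow> 0 + 0"
    by (intro tendsto_add)
  then have "\<forall>\<^sub>F H::nat in sequentially. ln K / real H + ln (real H) / real H < c"
    using assms by (intro order_tendstoD(2)[of _ 0]) auto
  then have "\<forall>\<^sub>F H::nat in sequentially. H > 0 \<and> ln K / real H + ln (real H) / real H < c"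
    using eventually_gt_at_top[of 0] by eventually_elim auto
  then obtain H :: nat where H: "H > 0" "ln K / real H + ln (real H) / real H < c"
    unfolding eventually_sequentially by blast
  then have "ln (K * H) = H * (ln K / real H + ln (real H) / real H)"
    using assms by (simp add: ln_mult field_simps)
  also have "\<dots> \<le> c * H" using H by (simp add: mult.commute)
  finally show ?thesis using H by blast
qed

text \<open>The bound is uniform in \<open>\<beta>\<close> although only a finite family of test functions can be controlled: on
  a segment of length \<open>H\<close> the frequencies \<open>p / Q\<close> with \<open>Q\<close> a large multiple of \<open>H\<close> approximate all the others.
  The family then has size linear in \<open>H\<close>, and its logarithm, which enters the discrepancy, is \<open>o(H)\<close>.\<close>

lemma rounding_initial_segment:
  assumes "\<epsilon> > 0"
  shows "\<exists>H>0. \<forall>w :: nat \<Rightarrow> real. (\<forall>j. 0 \<le> w j \<and> w j \<le> 1) \<longrightarrow>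
           (\<exists>x :: nat \<Rightarrow> bool. \<forall>\<beta>::real. \<forall>m\<le>H.
              norm (\<Sum>j<m. of_real (of_bool (x j) - w j) * e (real j * \<beta>)) \<le> \<epsilon> * real H)"
proof -
  \<comment> \<open>The discrepancy \<open>\<epsilon> H\<close> is split: the linear and the logarithmic term of the Chernoff bound
    take \<open>\<epsilon> / 8\<close> each, for the real and the imaginary part this makes \<open>\<epsilon> / 2\<close>, and the
    approximation of \<open>\<beta>\<close> by a grid frequency takes the other \<open>\<epsilon> / 2\<close>.\<close>
  define l where "l = min 1 (\<epsilon> / 8)"
  have l: "0 < l" "l \<le> 1" "l \<le> \<epsilon> / 8" using assms by (auto simp: l_def)
  define C :: nat where "C = nat \<lceil>4 * pi / \<epsilon>\<rceil> + 1"
  have C: "4 * pi / \<epsilon> \<le> C" "C > 0" unfolding C_def by linarith+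
  obtain H :: nat where H: "H > 0" "ln (4 * C * H) \<le> l * (\<epsilon> / 8) * H"
    using ln_le_linear_eventually[of "l * (\<epsilon> / 8)" "4 * C"] C l assms by auto
  define Q where "Q = C * H"
  have Q: "Q > 0" using C H by (simp add: Q_def)
  \<comment> \<open>One-sided bounds in these four directions bound the modulus of a complex number.\<close>
  define U where "U = {1, -1, \<i>, -\<i>}"
  define I where "I = {..<Q} \<times> U"
  define f where "f = (\<lambda>(p, u) j. Re (u * e (real j * (real p / real Q))))"
  have card_U: "card U = 4" by (simp add: U_def complex_eq_iff)
  have I: "finite I" "card I = 4 * C * H" by (simp_all add: I_def card_U U_def[THEN arg_cong[of _ _ finite]] Q_def)
  have f: "\<bar>f i j\<bar> \<le> 1" if "i \<in> I" for i j
  proof -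
    obtain p u where i: "i = (p, u)" by force
    have "norm u = 1" using that by (auto simp: i I_def U_def)
    then have "norm (u * e (real j * (real p / real Q))) = 1" by (simp add: norm_mult)
    then show ?thesis unfolding f_def i using abs_Re_le_cmod[of "u * e (real j * (real p / real Q))"] by simp
  qed
  show ?thesis
  proof (intro exI[of _ H] conjI allI impI)
    fix w :: "nat \<Rightarrow> real" assume w: "\<forall>j. 0 \<le> w j \<and> w j \<le> 1"
    obtain x :: "nat \<Rightarrow> bool" where x: "\<And>i m. i \<in> I \<Longrightarrow> m \<le> H \<Longrightarrow>
        (\<Sum>j<m. (of_bool (x j) - w j) * f i j) \<le> ln (card I) / l + l * m"
      using rounding_finite_family[of I f w l H, OF I(1) f] w l by blast
    have grid: "norm (\<Sum>j<m. of_real (of_bool (x j) - w j) * e (real j * (p / Q))) \<le> \<epsilon> / 2 * H"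
      if "p < Q" "m \<le> H" for p m
    proof -
      let ?z = "\<Sum>j<m. of_real (of_bool (x j) - w j) * e (real j * (p / Q))"
      have dir: "Re (u * ?z) \<le> \<epsilon> / 4 * H" if "u \<in> U" for u
      proof -
        have "Re (u * ?z) = (\<Sum>j<m. (of_bool (x j) - w j) * f (p, u) j)"
          by (simp add: sum_distrib_left f_def algebra_simps sum_subtractf sum.distrib)
        also have "\<dots> \<le> ln (card I) / l + l * m"
          using that \<open>p < Q\<close> \<open>m \<le> H\<close> by (intro x) (auto simp: I_def)
        also have "ln (card I) / l \<le> \<epsilon> / 8 * H"
          using H l by (simp add: I field_simps)
        also have "l * m \<le> \<epsilon> / 8 * H"
          using l \<open>m \<le> H\<close> assms by (intro mult_mono) auto
        finally show ?thesis by simp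
      qed
      have "\<bar>Re ?z\<bar> \<le> \<epsilon> / 4 * H" "\<bar>Im ?z\<bar> \<le> \<epsilon> / 4 * H"
        using dir[of 1] dir[of "-1"] dir[of "\<i>"] dir[of "-\<i>"] unfolding abs_le_iff
        by (simp_all add: U_def del: Re_sum Im_sum)
      then show ?thesis using cmod_le[of ?z] by linarith
    qed
    show "\<exists>x :: nat \<Rightarrow> bool. \<forall>\<beta>::real. \<forall>m\<le>H.
        norm (\<Sum>j<m. of_real (of_bool (x j) - w j) * e (real j * \<beta>)) \<le> \<epsilon> * real H"
    proof (intro exI[of _ x] allI impI)
      fix \<beta> :: real and m assume m: "m \<le> H"
      define p where "p = nat \<lfloor>Q * frac \<beta>\<rfloor>"
      have p': "real p = of_int \<lfloor>Q * frac \<beta>\<rfloor>" by (simp add: p_def)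
      have "Q * frac \<beta> < Q" using Q frac_lt_1[of \<beta>] by simp
      then have "real p < Q" unfolding p' by linarith
      then have p: "p < Q" by simp
      have close: "\<bar>frac \<beta> - p / Q\<bar> \<le> 1 / Q"
      proof -
        have "\<bar>Q * frac \<beta> - p\<bar> \<le> 1" unfolding p' by linarith
        then have "\<bar>Q * frac \<beta> - p\<bar> / Q \<le> 1 / Q" by (intro divide_right_mono) auto
        also have "\<bar>Q * frac \<beta> - p\<bar> / Q = \<bar>(Q * frac \<beta> - p) / Q\<bar>" by simp
        also have "(Q * frac \<beta> - p) / Q = frac \<beta> - p / Q" using Q by (simp add: field_simps)
        finally show ?thesis .
      qed
      have e_frac: "e (real j * \<beta>) = e (real j * frac \<beta>)" for j :: nat
        unfolding e_eq_iff by (simp add: frac_def algebra_simps)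
      have "norm ((\<Sum>j<m. of_real (of_bool (x j) - w j) * e (real j * \<beta>))
               - (\<Sum>j<m. of_real (of_bool (x j) - w j) * e (real j * (p / Q))))
          = norm (\<Sum>j<m. of_real (of_bool (x j) - w j) * (e (real j * frac \<beta>) - e (real j * (p / Q))))"
        unfolding e_frac by (simp add: ring_distribs flip: sum_subtractf)
      also have "\<dots> \<le> (\<Sum>j<m. \<epsilon> / 2)"
      proof (intro sum_norm_le)
        fix j assume j: "j \<in> {..<m}"
        have "norm (of_real (of_bool (x j) - w j) :: complex) \<le> 1"
          unfolding norm_of_real using w[rule_format, of j] by auto
        then have "norm (of_real (of_bool (x j) - w j) * (e (real j * frac \<beta>) - e (real j * (p / Q))))
          \<le> 1 * (2 * pi * \<bar>j * frac \<beta> - j * (p / Q)\<bar>)"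
          unfolding norm_mult
          by (intro mult_mono norm_e_diff_le) auto
        also have "\<bar>j * frac \<beta> - j * (p / Q)\<bar> = j * \<bar>frac \<beta> - p / Q\<bar>"
          by (simp only: right_diff_distrib[symmetric] abs_mult abs_of_nat)
        also have "\<dots> \<le> H * (1 / Q)" using j m close by (intro mult_mono) auto
        also have "H * (1 / Q) = 1 / C" using H by (simp add: Q_def)
        also have "1 * (2 * pi * (1 / C)) \<le> \<epsilon> / 2"
          using C assms by (simp add: field_simps)
        finally show "norm (of_real (of_bool (x j) - w j) * (e (real j * frac \<beta>) - e (real j * (p / Q))))
           \<le> \<epsilon> / 2" by simp
      qed
      also have "\<dots> \<le> \<epsilon> / 2 * H" using m assms by simp
      finally show "norm (\<Sum>j<m. of_real (of_bool (x j) - w j) * e (real j * \<beta>)) \<le> \<epsilon> * real H"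
        using grid[OF p m]
          norm_triangle_sub[of "\<Sum>j<m. of_real (of_bool (x j) - w j) * e (real j * \<beta>)"
            "\<Sum>j<m. of_real (of_bool (x j) - w j) * e (real j * (real p / real Q))"] by linarith
    qed
  qed (use H in simp)
qed

text \<open>Rounding separately in consecutive segments of a fixed length \<open>H\<close> extends the bound to all intervals;
  only the two segments at the ends of an interval may be incomplete, which costs a
  constant. It is essential that this constant depends on \<open>\<epsilon>\<close> only and not on the weights.\<close>

lemma rounding_intervals:
  assumes "\<epsilon> > 0"
  obtains C where "\<And>w :: nat \<Rightarrow> real. (\<And>j. 0 \<le> w j \<and> w j \<le> 1) \<Longrightarrow>
           (\<exists>x :: nat \<Rightarrow> bool. \<forall>\<beta>::real. \<forall>a b. a \<le> b \<longrightarrow>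
              norm (\<Sum>j=a..<b. of_real (of_bool (x j) - w j) * e (real j * \<beta>)) \<le> \<epsilon> * (real b - real a) + C)"
proof -
  obtain H where H: "H > 0" and rnd: "\<And>w :: nat \<Rightarrow> real. \<forall>j. 0 \<le> w j \<and> w j \<le> 1 \<Longrightarrow>
           (\<exists>x :: nat \<Rightarrow> bool. \<forall>\<beta>::real. \<forall>m\<le>H.
              norm (\<Sum>j<m. of_real (of_bool (x j) - w j) * e (real j * \<beta>)) \<le> \<epsilon> * real H)"
    using rounding_initial_segment[OF assms] by blast
  show ?thesis
  proof (rule that[of "3 * \<epsilon> * H"])
    fix w :: "nat \<Rightarrow> real" assume w: "\<And>j. 0 \<le> w j \<and> w j \<le> 1"
    have "\<exists>x. \<forall>q. \<forall>\<beta>::real. \<forall>m\<le>H.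
        norm (\<Sum>j<m. of_real (of_bool (x q j) - w (j + q * H)) * e (real j * \<beta>)) \<le> \<epsilon> * real H"
      by (rule choice) (intro allI rnd, use w in simp)
    then obtain x where x: "\<And>q \<beta> m. m \<le> H \<Longrightarrow>
        norm (\<Sum>j<m. of_real (of_bool (x q j) - w (j + q * H)) * e (real j * \<beta>)) \<le> \<epsilon> * real H"
      by blast
    define y where "y n = x (n div H) (n mod H)" for n
    show "\<exists>x :: nat \<Rightarrow> bool. \<forall>\<beta>::real. \<forall>a b. a \<le> b \<longrightarrow>
       norm (\<Sum>j=a..<b. of_real (of_bool (x j) - w j) * e (real j * \<beta>)) \<le> \<epsilon> * (real b - real a) + 3 * \<epsilon> * H"
    proof (intro exI[of _ y] allI impI)
      fix \<beta> :: real and a b :: nat assume ab: "a \<le> b"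
      define g where "g j = of_real (of_bool (y j) - w j) * e (real j * \<beta>)" for j
      have partial: "norm (sum g {q * H..<q * H + m}) \<le> \<epsilon> * H" if "m \<le> H" for q m
      proof -
        have "sum g {q * H..<q * H + m} = (\<Sum>j<m. g (j + q * H))"
          using sum.shift_bounds_nat_ivl[of g 0 "q * H" m] by (simp add: atLeast0LessThan add.commute)
        also have "\<dots> = (\<Sum>j<m. e (q * H * \<beta>) * (of_real (of_bool (x q j) - w (j + q * H)) * e (real j * \<beta>)))"
          using that by (intro sum.cong) (auto simp: g_def y_def ring_distribs e_add)
        finally show ?thesis using x[OF that] by (simp add: norm_mult flip: sum_distrib_left)
      qed
      have blocks: "norm (sum g {q * H..<(q + n) * H}) \<le> \<epsilon> * H * n" for q n
      proof (induction n)
        case (Suc n)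
        have "sum g {q * H..<(q + Suc n) * H}
            = sum g {q * H..<(q + n) * H} + sum g {(q + n) * H..<(q + n) * H + H}"
          by (subst sum.atLeastLessThan_concat) (auto simp: algebra_simps)
        also have "norm \<dots> \<le> norm (sum g {q * H..<(q + n) * H}) + norm (sum g {(q + n) * H..<(q + n) * H + H})"
          by (rule norm_triangle_ineq)
        also have "\<dots> \<le> \<epsilon> * H * n + \<epsilon> * H"
          using Suc partial[of H "q + n"] by (intro add_mono) auto
        finally show ?case by (simp add: algebra_simps)
      qed auto
      define p q where "p = a div H" and "q = b div H"
      have pq: "p \<le> q" using ab by (simp add: p_def q_def div_le_mono)
      have a: "a = p * H + a mod H" and b: "b = q * H + b mod H" by (simp_all add: p_def q_def)
      have "sum g {p * H..<a} + sum g {a..<b} = sum g {p * H..<q * H} + sum g {q * H..<b}"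
        using a b ab pq sum.atLeastLessThan_concat[of "p * H" a b g]
          sum.atLeastLessThan_concat[of "p * H" "q * H" b g] by simp
      then have split: "sum g {a..<b} = sum g {p * H..<q * H} + sum g {q * H..<b} - sum g {p * H..<a}"
        by (simp add: algebra_simps)
      have "norm (sum g {a..<b}) \<le> norm (sum g {p * H..<q * H}) + norm (sum g {q * H..<b})
           + norm (sum g {p * H..<a})"
        unfolding split using norm_triangle_ineq4[of "sum g {p * H..<q * H} + sum g {q * H..<b}" "sum g {p * H..<a}"]
          norm_triangle_ineq[of "sum g {p * H..<q * H}" "sum g {q * H..<b}"] by linarith
      also have "norm (sum g {p * H..<q * H}) \<le> \<epsilon> * H * (q - p)"
        using blocks[of p "q - p"] pq by (simp add: of_nat_diff)
      also have "norm (sum g {q * H..<b}) \<le> \<epsilon> * H"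
        using partial[of "b mod H" q] H b by simp
      also have "norm (sum g {p * H..<a}) \<le> \<epsilon> * H"
        using partial[of "a mod H" p] H a by simp
      also have "\<epsilon> * H * real (q - p) \<le> \<epsilon> * (real b - real a + H)"
      proof -
        have "q * H + a \<le> b + p * H + H" using a b H mod_less_divisor[of H a] by linarith
        then have "real (q * H + a) \<le> real (b + p * H + H)" by (rule of_nat_mono)
        then have "real H * real (q - p) \<le> real b - real a + H" using pq
          by (simp add: of_nat_diff algebra_simps)
        then show ?thesis using assms by (simp add: mult.assoc)
      qed
      finally show "norm (\<Sum>j=a..<b. of_real (of_bool (y j) - w j) * e (real j * \<beta>))
          \<le> \<epsilon> * (real b - real a) + 3 * \<epsilon> * H"
        by (simp add: g_def algebra_simps)
    qed
  qed
qed

section \<open>Gluing blocks\<close>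

lemma sum_enumerate:
  fixes f :: "nat \<Rightarrow> 'a::comm_monoid_add"
  assumes "infinite S"
  shows "(\<Sum>n<N. f (enumerate S n)) = (\<Sum>m | m \<in> S \<and> m < enumerate S N. f m)"
proof (rule sum.reindex_bij_betw)
  show "bij_betw (enumerate S) {..<N} {m. m \<in> S \<and> m < enumerate S N}"
    unfolding bij_betw_def
  proof
    show "inj_on (enumerate S) {..<N}"
      using strict_mono_enumerate[OF assms] by (rule strict_mono_imp_inj_on)
    have "m \<in> enumerate S ` {..<N}" if m: "m \<in> S" "m < enumerate S N" for m
    proof -
      obtain n where n: "enumerate S n = m" using enumerate_Ex[OF assms m(1)] by blast
      then have "n < N" using m(2) assms by (simp flip: n)
      then show ?thesis using n by blast
    qed
    then show "enumerate S ` {..<N} = {m. m \<in> S \<and> m < enumerate S N}"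
      using assms by (auto simp: enumerate_in_set)
  qed
qed

text \<open>The average over the first \<open>N\<close> elements of \<open>S\<close> is the quotient of two sums over an initial segment of
  the integers, namely those for \<open>\<beta>\<close> and for \<open>0\<close>. So \<open>W\<close> may be any normalisation for which these sums converge.\<close>

lemma averages_along_enumerate:
  fixes W :: "nat \<Rightarrow> real" and c :: "real \<Rightarrow> complex"
  assumes W: "filterlim W at_top sequentially"
    and lim: "\<And>\<beta>. (\<lambda>P. (\<Sum>n<P. of_bool (n \<in> S) * e (real n * \<beta>)) / of_real (W P)) \<longlonglongrightarrow> c \<beta>"
    and c0: "c 0 = 1"
  shows "infinite S"
    and "(\<lambda>N. (1 / of_nat N) * (\<Sum>n<N. e (real (enumerate S n) * \<beta>))) \<longlonglongrightarrow> c \<beta>"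
proof -
  define T where "T \<beta> P = (\<Sum>n<P. of_bool (n \<in> S) * e (real n * \<beta>))" for \<beta> and P :: nat
  have T: "T \<beta> P = (\<Sum>n | n \<in> S \<and> n < P. e (real n * \<beta>))" for \<beta> P
    unfolding T_def by (intro sum.mono_neutral_cong_right) auto
  have lim': "(\<lambda>P. T \<beta> P / of_real (W P)) \<longlonglongrightarrow> c \<beta>" for \<beta>
    using lim by (simp add: T_def)
  show inf: "infinite S"
  proof
    assume fin: "finite S"
    have "(\<lambda>P. of_real (real (card S) / W P) :: complex) \<longlonglongrightarrow> of_real 0"
      by (intro tendsto_of_real real_tendsto_divide_at_top[OF tendsto_const W])
    moreover have "\<forall>\<^sub>F P in sequentially. T 0 P / of_real (W P) = of_real (real (card S) / W P)"
    proof (intro eventually_sequentiallyI)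
      fix P assume "Suc (Max (insert 0 S)) \<le> P"
      then have "n < P" if "n \<in> S" for n
        using that fin by (meson Max_ge finite_insert insertI2 le_imp_less_Suc less_le_trans)
      then have "{n. n \<in> S \<and> n < P} = S" by auto
      then show "T 0 P / of_real (W P) = of_real (real (card S) / W P)"
        by (simp add: T)
    qed
    ultimately have "(\<lambda>P. T 0 P / of_real (W P)) \<longlonglongrightarrow> of_real 0"
      by (subst tendsto_cong)
    then show False using lim'[of 0] c0 LIMSEQ_unique by fastforce
  qed
  have s: "strict_mono (enumerate S)"
    using inf by (rule strict_mono_enumerate)
  have "(\<lambda>P. (T \<beta> P / of_real (W P)) / (T 0 P / of_real (W P))) \<longlonglongrightarrow> c \<beta> / c 0"
    by (intro tendsto_divide lim') (simp add: c0)
  then have "(\<lambda>N. (T \<beta> (enumerate S N) / of_real (W (enumerate S N))) /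
                (T 0 (enumerate S N) / of_real (W (enumerate S N)))) \<longlonglongrightarrow> c \<beta> / c 0"
    using LIMSEQ_subseq_LIMSEQ[OF _ s] by (fastforce simp: o_def)
  moreover have "\<forall>\<^sub>F N in sequentially.
     (T \<beta> (enumerate S N) / of_real (W (enumerate S N))) / (T 0 (enumerate S N) / of_real (W (enumerate S N)))
      = (1 / of_nat N) * (\<Sum>n<N. e (real (enumerate S n) * \<beta>))"
  proof -
    have "\<forall>\<^sub>F P in sequentially. W P > 0"
      using W by (rule filterlim_at_top_dense[THEN iffD1, rule_format])
    then have "\<forall>\<^sub>F N in sequentially. W (enumerate S N) > 0"
      using filterlim_subseq[OF s] by (rule eventually_compose_filterlim)
    then show ?thesis
    proof eventually_elim
      case (elim N)
      have "T 0 (enumerate S N) = of_nat N"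
        unfolding T sum_enumerate[OF inf, symmetric] by simp
      moreover have "T \<beta> (enumerate S N) = (\<Sum>n<N. e (real (enumerate S n) * \<beta>))"
        unfolding T sum_enumerate[OF inf, symmetric] ..
      ultimately show ?case using elim by (simp add: field_simps)
    qed
  qed
  ultimately show "(\<lambda>N. (1 / of_nat N) * (\<Sum>n<N. e (real (enumerate S n) * \<beta>))) \<longlonglongrightarrow> c \<beta>"
    using c0 by (simp add: tendsto_cong)
qed

text \<open>The set agrees with \<open>X k\<close> on the \<open>k\<close>-th block. Its mean density there is \<open>d k\<close>, hence \<open>d\<close> is the natural
  weight, and the errors relative to it, \<open>\<epsilon> * d k\<close> per integer, add up to \<open>\<epsilon>\<close> times the total weight.
  The bounds \<open>B k\<close> are known before the blocks are chosen, so they can be made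
  negligible by long blocks. The bounds \<open>B'\<close> depend on \<open>\<beta>\<close> and \<open>\<epsilon>\<close>, but they are the same for all blocks, and it is
  enough that the total weight grows faster than the number of blocks.\<close>

lemma glue_blocks:
  fixes X :: "nat \<Rightarrow> nat \<Rightarrow> bool" and d B :: "nat \<Rightarrow> real" and c :: "real \<Rightarrow> complex"
  assumes d: "\<And>k. d k > 0" and B: "\<And>k. B k \<ge> 0"
    and est: "\<And>\<beta> \<epsilon>. \<epsilon> > 0 \<Longrightarrow> \<exists>k0 B'. \<forall>k\<ge>k0. \<forall>a b. a \<le> b \<longrightarrow>
       norm ((\<Sum>n=a..<b. of_bool (X k n) * e (real n * \<beta>)) - of_real (d k * (real b - real a)) * c \<beta>)
         \<le> \<epsilon> * (d k * (real b - real a)) + B k + B'"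
    and c0: "c 0 = 1"
  shows "\<exists>S. infinite S \<and> 0 \<notin> S \<and>
     (\<forall>\<beta>. (\<lambda>N. (1 / of_nat N) * (\<Sum>n<N. e (real (enumerate S n) * \<beta>))) \<longlonglongrightarrow> c \<beta>)"
proof -
  \<comment> \<open>\<open>G k\<close> is the total weight that has to precede the \<open>k\<close>-th block: at least
    \<open>k\<close> times the sum of the bounds up to this block; the extra summand \<open>k + 1\<close> takes care of
    \<open>B'\<close>, which counts once per block. The first block starts at \<open>1\<close>, which keeps \<open>0\<close> out of the set.\<close>
  define G where "G k = real k * ((\<Sum>i\<le>k. B i) + k + 1)" for k :: nat
  define L where "L k = nat \<lceil>G (Suc k) / d k\<rceil> + 1" for k
  define N where "N = rec_nat (1::nat) (\<lambda>k n. n + L k)"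
  have N_0 [simp]: "N 0 = 1" and N_Suc: "N (Suc k) = N k + L k" for k
    by (simp_all add: N_def)
  have L_pos: "L k > 0" for k by (simp add: L_def)
  have L: "G (Suc k) \<le> d k * real (L k)" for k
  proof -
    have "G (Suc k) / d k \<le> real (L k)" unfolding L_def by linarith
    then show ?thesis using d[of k] by (simp add: field_simps)
  qed
  have "strict_mono N" unfolding strict_mono_Suc_iff N_Suc using L_pos by simp
  then have N_mono: "i \<le> j \<Longrightarrow> N i \<le> N j" for i j by (simp add: strict_mono_less_eq)
  have N_ge: "k < N k" for k
  proof (induction k)
    case (Suc k)
    then show ?case using L_pos[of k] by (simp add: N_Suc)
  qed simp
  \<comment> \<open>The index of the block that contains \<open>n\<close>.\<close>
  define kappa where "kappa n = (LEAST k. n < N (Suc k))" for n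
  have kappa: "kappa n = k" if "N k \<le> n" "n < N (Suc k)" for n k
    unfolding kappa_def
  proof (rule Least_equality)
    fix i assume "n < N (Suc i)"
    then have "N k < N (Suc i)" using that by simp
    then have "k < Suc i" using \<open>strict_mono N\<close> by (simp add: strict_mono_less)
    then show "k \<le> i" by simp
  qed (use that in simp)
  have block_ex: "\<exists>k. N k \<le> n \<and> n < N (Suc k)" if "n \<ge> 1" for n
  proof -
    have "n < N (Suc (kappa n))"
      unfolding kappa_def by (rule LeastI[of _ n]) (use N_ge[of "Suc n"] in simp)
    moreover have "N (kappa n) \<le> n"
    proof (cases "kappa n")
      case (Suc i)
      then have "\<not> n < N (Suc i)" using not_less_Least[of i "\<lambda>k. n < N (Suc k)"] by (simp add: kappa_def)
      then show ?thesis using Suc by simp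
    qed (use that in simp)
    ultimately show ?thesis by blast
  qed
  define S where "S = {n. 1 \<le> n \<and> X (kappa n) n}"
  define W where "W P = (\<Sum>n<P. if 1 \<le> n then d (kappa n) else 0)" for P
  define T where "T \<beta> P = (\<Sum>n<P. of_bool (n \<in> S) * e (real n * \<beta>))" for \<beta> P
  define Er where "Er \<beta> P = T \<beta> P - of_real (W P) * c \<beta>" for \<beta> P
  have W_mono: "W P \<le> W Q" if "P \<le> Q" for P Q
    unfolding W_def using that d by (intro sum_mono2) (auto simp: less_imp_le)
  have W_nonneg: "0 \<le> W P" for P
    unfolding W_def using d by (intro sum_nonneg) (auto simp: less_imp_le)
  have N_pos: "1 \<le> N k" for k using N_mono[of 0 k] by simp
  have W_block: "W P = W (N k) + d k * (real P - real (N k))" if "N k \<le> P" "P \<le> N (Suc k)" for k P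
  proof -
    have "W P = W (N k) + (\<Sum>n=N k..<P. if 1 \<le> n then d (kappa n) else 0)"
      unfolding W_def lessThan_atLeast0 using that by (intro sum.atLeastLessThan_concat[symmetric]) auto
    also have "(\<Sum>n=N k..<P. if 1 \<le> n then d (kappa n) else 0) = (\<Sum>n=N k..<P. d k)"
      using that N_pos[of k] by (intro sum.cong) (auto simp: kappa)
    finally show ?thesis using that by (simp add: of_nat_diff mult.commute)
  qed
  have T_block: "T \<beta> P = T \<beta> (N k) + (\<Sum>n=N k..<P. of_bool (X k n) * e (real n * \<beta>))"
    if "N k \<le> P" "P \<le> N (Suc k)" for k P \<beta>
  proof -
    have "T \<beta> P = T \<beta> (N k) + (\<Sum>n=N k..<P. of_bool (n \<in> S) * e (real n * \<beta>))"
      unfolding T_def lessThan_atLeast0 using that by (intro sum.atLeastLessThan_concat[symmetric]) auto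
    also have "(\<Sum>n=N k..<P. of_bool (n \<in> S) * e (real n * \<beta>)) = (\<Sum>n=N k..<P. of_bool (X k n) * e (real n * \<beta>))"
      using that N_pos[of k] by (intro sum.cong) (auto simp: S_def kappa)
    finally show ?thesis .
  qed
  have W_ge: "G k \<le> W P" if "N k \<le> P" for k P
  proof (cases k)
    case 0
    then show ?thesis using W_nonneg by (simp add: G_def)
  next
    case (Suc i)
    have "G k \<le> d i * real (L i)" using L Suc by simp
    also have "\<dots> \<le> W (N i) + d i * real (L i)" using W_nonneg by simp
    also have "\<dots> = W (N k)" using W_block[of i "N k"] N_mono[of i k] Suc by (simp add: N_Suc)
    finally show ?thesis using W_mono[OF that] by simp
  qed
  have small: "\<forall>\<^sub>F P in sequentially. norm (Er \<beta> P) \<le> \<epsilon> * W P" if eps: "\<epsilon> > 0" for \<beta> \<epsilon>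
  proof -
    obtain k0 B' where *: "\<And>k a b. k \<ge> k0 \<Longrightarrow> a \<le> b \<Longrightarrow>
       norm ((\<Sum>n=a..<b. of_bool (X k n) * e (real n * \<beta>)) - of_real (d k * (real b - real a)) * c \<beta>)
         \<le> \<epsilon> / 2 * (d k * (real b - real a)) + B k + B'"
      using est[of "\<epsilon> / 2" \<beta>] half_gt_zero[OF eps] by blast
    define A where "A = max 0 B'"
    have block_step: "norm (Er \<beta> P) \<le> norm (Er \<beta> (N k)) + \<epsilon> / 2 * (W P - W (N k)) + B k + A"
      if "k \<ge> k0" "N k \<le> P" "P \<le> N (Suc k)" for k P
    proof -
      have "Er \<beta> P = Er \<beta> (N k) + ((\<Sum>n=N k..<P. of_bool (X k n) * e (real n * \<beta>))
                - of_real (d k * (real P - real (N k))) * c \<beta>)"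
        unfolding Er_def T_block[OF that(2,3)] W_block[OF that(2,3)] by (simp add: algebra_simps)
      then have "norm (Er \<beta> P) \<le> norm (Er \<beta> (N k)) + norm ((\<Sum>n=N k..<P. of_bool (X k n) * e (real n * \<beta>))
                - of_real (d k * (real P - real (N k))) * c \<beta>)"
        by (simp only: norm_triangle_ineq)
      also have "norm ((\<Sum>n=N k..<P. of_bool (X k n) * e (real n * \<beta>))
                - of_real (d k * (real P - real (N k))) * c \<beta>) \<le> \<epsilon> / 2 * (d k * (real P - real (N k))) + B k + B'"
        by (rule *[OF that(1,2)])
      also have "\<dots> \<le> \<epsilon> / 2 * (d k * (real P - real (N k))) + B k + A" by (simp add: A_def)
      finally show ?thesis using W_block[OF that(2,3)] by simp
    qed
    define E0 where "E0 = norm (Er \<beta> (N k0))"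
    \<comment> \<open>The terms \<open>W\<close> telescope, so the factor \<open>\<epsilon> / 2\<close> is not multiplied by the number of blocks.\<close>
    have ends: "norm (Er \<beta> (N k)) \<le> E0 + \<epsilon> / 2 * W (N k) + (\<Sum>i<k. B i) + k * A" if "k \<ge> k0" for k
      using that
    proof (induction k rule: dec_induct)
      case base
      then show ?case using W_nonneg eps B by (simp add: E0_def A_def sum_nonneg)
    next
      case (step k)
      then show ?case using block_step[of k "N (Suc k)"] N_mono[of k "Suc k"]
        by (simp add: algebra_simps)
    qed
    obtain k1 :: nat where k1: "(E0 + 1 + A) * 2 / \<epsilon> < k1" using reals_Archimedean2 by blast
    define K where "K = max (max k0 k1) 1"
    show ?thesis
    proof (intro eventually_sequentiallyI)
      fix P assume P: "N K \<le> P"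
      then obtain k where k: "N k \<le> P" "P < N (Suc k)" using block_ex[of P] N_pos[of K] by auto
      have "N K < N (Suc k)" using k P by simp
      then have "K \<le> k" using \<open>strict_mono N\<close> by (simp add: strict_mono_less)
      then have ks: "k \<ge> k0" "k \<ge> k1" "k \<ge> 1" by (auto simp: K_def)
      have E0: "E0 \<ge> 0" and A: "A \<ge> 0" by (simp_all add: E0_def A_def)
      have sB: "0 \<le> (\<Sum>i\<le>k. B i)" using B by (intro sum_nonneg) auto
      have "norm (Er \<beta> P) \<le> E0 + \<epsilon> / 2 * W P + (\<Sum>i\<le>k. B i) + (k + 1) * A"
        using block_step[OF ks(1) k(1)] k ends[OF ks(1)]
        by (simp add: algebra_simps lessThan_Suc_atMost[symmetric])
      also have "E0 + (\<Sum>i\<le>k. B i) + (k + 1) * A \<le> (E0 + 1 + A) * ((\<Sum>i\<le>k. B i) + k + 1)"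
        using E0 A sB by (simp add: algebra_simps)
      then have "E0 + \<epsilon> / 2 * W P + (\<Sum>i\<le>k. B i) + (k + 1) * A
           \<le> \<epsilon> / 2 * W P + (E0 + 1 + A) * ((\<Sum>i\<le>k. B i) + k + 1)" by simp
      also have "(E0 + 1 + A) * ((\<Sum>i\<le>k. B i) + k + 1) \<le> (\<epsilon> / 2 * k) * ((\<Sum>i\<le>k. B i) + k + 1)"
      proof (rule mult_right_mono)
        have "(E0 + 1 + A) * 2 / \<epsilon> \<le> real k" using k1 ks(2) by linarith
        then show "E0 + 1 + A \<le> \<epsilon> / 2 * k" using eps by (simp add: field_simps)
      qed (use sB in simp)
      also have "\<dots> = \<epsilon> / 2 * G k" by (simp add: G_def)
      also have "\<dots> \<le> \<epsilon> / 2 * W P" using W_ge[OF k(1)] eps by simp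
      finally show "norm (Er \<beta> P) \<le> \<epsilon> * W P" by simp
    qed
  qed
  have W_top: "filterlim W at_top sequentially"
    unfolding filterlim_at_top
  proof
    fix Z :: real
    obtain k :: nat where k: "Z < k" using reals_Archimedean2 by blast
    show "\<forall>\<^sub>F P in sequentially. Z \<le> W P"
    proof (intro eventually_sequentiallyI)
      fix P assume "N (Suc k) \<le> P"
      then have "G (Suc k) \<le> W P" by (rule W_ge)
      moreover have "0 \<le> (\<Sum>i\<le>Suc k. B i)" using B by (intro sum_nonneg) auto
      then have "1 * real (Suc k) \<le> G (Suc k)" unfolding G_def by (subst mult.commute) (intro mult_mono, auto)
      ultimately show "Z \<le> W P" using k by simp
    qed
  qed
  have lim: "(\<lambda>P. T \<beta> P / of_real (W P)) \<longlonglongrightarrow> c \<beta>" for \<beta>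
  proof (rule tendstoI)
    fix \<epsilon> :: real assume eps: "\<epsilon> > 0"
    have "\<forall>\<^sub>F P in sequentially. W P > 0"
      using W_top by (rule filterlim_at_top_dense[THEN iffD1, rule_format])
    with small[OF half_gt_zero[OF eps], of \<beta>] show "\<forall>\<^sub>F P in sequentially. dist (T \<beta> P / of_real (W P)) (c \<beta>) < \<epsilon>"
    proof eventually_elim
      case (elim P)
      have "dist (T \<beta> P / of_real (W P)) (c \<beta>) = norm (Er \<beta> P / of_real (W P))"
        using elim(2) by (simp add: dist_norm Er_def diff_divide_distrib)
      also have "\<dots> = norm (Er \<beta> P) / W P" using elim(2) by (simp add: norm_divide)
      also have "\<dots> \<le> \<epsilon> / 2" using elim eps by (simp add: field_simps)
      finally show ?case using eps by simp
    qed
  qed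
  show ?thesis
    using averages_along_enumerate[OF W_top lim[unfolded T_def] c0]
    by (intro exI[of _ S]) (auto simp: S_def)
qed

section \<open>Fejer means along an irrational rotation\<close>

text \<open>The geometric sum, written without division so that it also covers the ratio \<open>1\<close>.\<close>

lemma norm_sum_e_le:
  "norm (\<Sum>m=a..<b. e (real m * \<theta>)) * norm (1 - e \<theta>) \<le> 2"
proof (cases "a \<le> b")
  case True
  have "(\<Sum>m=a..<b. e (real m * \<theta>)) * (1 - e \<theta>) = e (real a * \<theta>) - e (real b * \<theta>)"
  proof -
    have "(\<Sum>m=a..<b. e (real m * \<theta>)) * (1 - e \<theta>) = - (\<Sum>m=a..<b. e (real (Suc m) * \<theta>) - e (real m * \<theta>))"
      unfolding sum_distrib_right sum_negf[symmetric]
      by (intro sum.cong) (simp_all add: algebra_simps e_add)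
    also have "\<dots> = e (real a * \<theta>) - e (real b * \<theta>)"
      using sum_Suc_diff'[OF True, of "\<lambda>m. e (real m * \<theta>)"] by simp
    finally show ?thesis .
  qed
  then have "norm (\<Sum>m=a..<b. e (real m * \<theta>)) * norm (1 - e \<theta>) = norm (e (real a * \<theta>) - e (real b * \<theta>))"
    by (simp flip: norm_mult)
  also have "\<dots> \<le> norm (e (real a * \<theta>)) + norm (e (real b * \<theta>))" by (rule norm_triangle_ineq4)
  finally show ?thesis by simp
qed auto

lemma e_int_mult_ne_1:
  assumes "\<alpha> \<notin> \<rat>" "j \<noteq> 0"
  shows "e (of_int j * \<alpha>) \<noteq> 1"
proof
  assume "e (of_int j * \<alpha>) = 1"
  then obtain n where "of_int j * \<alpha> = of_int n" by (auto simp: e_eq_1_iff Ints_def)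
  then have "\<alpha> = of_int n / of_int j" using assms by (simp add: field_simps)
  then show False using assms by (simp add: Rats_divide)
qed

text \<open>The limit \<open>c(\<beta>)\<close>: the mean of \<open>e(m (j \<alpha> + \<beta>))\<close> over \<open>m\<close> is \<open>1\<close> if \<open>j \<alpha> + \<beta>\<close> is an integer, and \<open>0\<close> otherwise,
  so only a resonant \<open>j\<close> survives in the mean of \<open>\<Sum>j. a j * e(m (j \<alpha> + \<beta>))\<close>.\<close>

definition resonant_coeff :: "real \<Rightarrow> (int \<Rightarrow> complex) \<Rightarrow> real \<Rightarrow> complex" where
  "resonant_coeff \<alpha> a \<beta> = (if \<exists>j. e (of_int j * \<alpha> + \<beta>) = 1
      then a (THE j. e (of_int j * \<alpha> + \<beta>) = 1) else 0)"

lemma resonance_unique: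
  assumes "\<alpha> \<notin> \<rat>" "e (of_int i * \<alpha> + \<beta>) = 1" "e (of_int j * \<alpha> + \<beta>) = 1"
  shows "i = j"
proof -
  have "e (of_int i * \<alpha> + \<beta>) = e (of_int j * \<alpha> + \<beta>)" using assms by simp
  then have "e (of_int (i - j) * \<alpha>) = 1" by (simp add: e_eq_iff e_eq_1_iff algebra_simps)
  then show ?thesis using e_int_mult_ne_1[OF assms(1), of "i - j"] by auto
qed

lemma resonant_coeff_eq:
  assumes "\<alpha> \<notin> \<rat>" "e (of_int j * \<alpha> + \<beta>) = 1"
  shows "resonant_coeff \<alpha> a \<beta> = a j"
proof -
  have "(THE i. e (of_int i * \<alpha> + \<beta>) = 1) = j"
    using assms resonance_unique by (intro the_equality) auto
  then show ?thesis using assms by (auto simp: resonant_coeff_def)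
qed

lemma resonant_coeff_eq_0:
  assumes "\<And>j. e (of_int j * \<alpha> + \<beta>) \<noteq> 1"
  shows "resonant_coeff \<alpha> a \<beta> = 0"
  using assms by (simp add: resonant_coeff_def)

text \<open>If the ratios with indices \<open>i\<close> and \<open>j\<close> were both close to \<open>1\<close>, then so would be \<open>e((i - j) \<alpha>)\<close>, which
  for distinct elements of the finite set \<open>J\<close> stays away from \<open>1\<close>. The point is that the resulting bound
  is uniform in \<open>\<beta>\<close>: the single index \<open>i\<close> absorbs all small denominators.\<close>

lemma interval_sum_off_resonance:
  assumes \<alpha>: "\<alpha> \<notin> \<rat>" and J: "finite (J :: int set)"
  shows "\<exists>B\<ge>0. \<forall>\<beta>. \<exists>i. (\<forall>j. e (of_int j * \<alpha> + \<beta>) = 1 \<longrightarrow> j \<in> J \<longrightarrow> i = j) \<and>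
     (\<forall>c :: int \<Rightarrow> complex. (\<forall>j\<in>J. norm (c j) \<le> 1) \<longrightarrow> (\<forall>a b.
       norm (\<Sum>j\<in>J - {i}. c j * (\<Sum>m=a..<b. e (real m * (of_int j * \<alpha> + \<beta>)))) \<le> B))"
proof -
  define D where "D = insert 1 ((\<lambda>(i, j). norm (1 - e (of_int (i - j) * \<alpha>))) ` (J \<times> J - Id))"
  have fin: "finite D" unfolding D_def using J by auto
  have "D \<noteq> {}" by (simp add: D_def)
  define \<delta> where "\<delta> = Min D"
  have "0 < norm (1 - e (of_int (i - j) * \<alpha>))" if "i \<noteq> j" for i j
    using e_int_mult_ne_1[OF \<alpha>, of "i - j"] that by (simp del: of_int_diff)
  then have \<delta>: "\<delta> > 0"
    unfolding \<delta>_def using fin \<open>D \<noteq> {}\<close>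
    by (subst Min_gr_iff) (auto simp: D_def simp del: of_int_diff zero_less_norm_iff)
  have sep: "\<delta> \<le> norm (1 - e (of_int (i - j) * \<alpha>))" if "i \<in> J" "j \<in> J" "i \<noteq> j" for i j
    unfolding \<delta>_def using fin that by (intro Min_le) (force simp: D_def)+
  define B where "B = card J * (4 / \<delta>)"
  have "\<exists>i. (\<forall>j. e (of_int j * \<alpha> + \<beta>) = 1 \<longrightarrow> j \<in> J \<longrightarrow> i = j) \<and>
     (\<forall>c :: int \<Rightarrow> complex. (\<forall>j\<in>J. norm (c j) \<le> 1) \<longrightarrow> (\<forall>a b.
       norm (\<Sum>j\<in>J - {i}. c j * (\<Sum>m=a..<b. e (real m * (of_int j * \<alpha> + \<beta>)))) \<le> B))" for \<beta>
  proof -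
    define close where "close j \<longleftrightarrow> j \<in> J \<and> norm (1 - e (of_int j * \<alpha> + \<beta>)) < \<delta> / 2" for j
    have uniq: "i = j" if "close i" "close j" for i j
    proof (rule ccontr)
      assume "i \<noteq> j"
      then have "\<delta> \<le> norm (1 - e (of_int (i - j) * \<alpha>))" using that sep by (auto simp: close_def)
      also have "\<dots> = norm (e (of_int j * \<alpha> + \<beta>) * (1 - e (of_int (i - j) * \<alpha>)))"
        by (simp add: norm_mult)
      also have "e (of_int j * \<alpha> + \<beta>) * (1 - e (of_int (i - j) * \<alpha>))
          = (1 - e (of_int i * \<alpha> + \<beta>)) - (1 - e (of_int j * \<alpha> + \<beta>))"
        by (simp add: algebra_simps flip: e_add)
      also have "norm \<dots> \<le> norm (1 - e (of_int i * \<alpha> + \<beta>)) + norm (1 - e (of_int j * \<alpha> + \<beta>))"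
        by (rule norm_triangle_ineq4)
      finally show False using that by (simp add: close_def)
    qed
    obtain i where i: "\<And>j. close j \<Longrightarrow> i = j" using uniq by blast
    show ?thesis
    proof (intro exI[of _ i] conjI allI impI)
      fix j assume "e (of_int j * \<alpha> + \<beta>) = 1" "j \<in> J"
      then show "i = j" using \<delta> by (intro i) (simp add: close_def)
    next
      fix c :: "int \<Rightarrow> complex" and a b assume c: "\<forall>j\<in>J. norm (c j) \<le> 1"
      have "norm (\<Sum>j\<in>J - {i}. c j * (\<Sum>m=a..<b. e (real m * (of_int j * \<alpha> + \<beta>)))) \<le> (\<Sum>j\<in>J - {i}. 4 / \<delta>)"
      proof (intro sum_norm_le)
        fix j assume j: "j \<in> J - {i}"
        let ?s = "\<Sum>m=a..<b. e (real m * (of_int j * \<alpha> + \<beta>))"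
        have "\<not> close j" using j i by blast
        then have "\<delta> / 2 \<le> norm (1 - e (of_int j * \<alpha> + \<beta>))" using j by (simp add: close_def not_less)
        then have "norm ?s * (\<delta> / 2) \<le> norm ?s * norm (1 - e (of_int j * \<alpha> + \<beta>))"
          by (intro mult_left_mono) auto
        also have "\<dots> \<le> 2" by (rule norm_sum_e_le)
        finally have "norm ?s \<le> 4 / \<delta>" using \<delta> by (simp add: field_simps)
        then have "norm (c j) * norm ?s \<le> 1 * (4 / \<delta>)" using c j by (intro mult_mono) auto
        then show "norm (c j * ?s) \<le> 4 / \<delta>" by (simp add: norm_mult)
      qed
      also have "\<dots> \<le> B" unfolding B_def using \<delta> J
        by (simp add: mult_right_mono card_mono divide_right_mono del: times_divide_eq_right)
      finally show "norm (\<Sum>j\<in>J - {i}. c j * (\<Sum>m=a..<b. e (real m * (of_int j * \<alpha> + \<beta>)))) \<le> B" .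
    qed
  qed
  moreover have "B \<ge> 0" using \<delta> by (simp add: B_def)
  ultimately show ?thesis by blast
qed

text \<open>The Cesaro means of the formal trigonometric series \<open>\<Sum>j. a j * e(j x)\<close>. The damping factors
  will make them nonnegative when \<open>a\<close> comes from a measure.\<close>

definition fejer_mean :: "(int \<Rightarrow> complex) \<Rightarrow> nat \<Rightarrow> real \<Rightarrow> complex" where
  "fejer_mean a k x = (\<Sum>j\<in>{- int k<..<int k}. of_real (1 - \<bar>of_int j\<bar> / real k) * a j * e (of_int j * x))"

text \<open>Convergence is not uniform in \<open>\<beta>\<close>: for bad \<open>\<beta>\<close> and arbitrarily large \<open>k\<close> some \<open>j \<alpha> + \<beta>\<close> with \<open>\<bar>j\<bar> < k\<close> can be so close
  to an integer that its geometric sum has not started to decay. For fixed \<open>\<beta>\<close> such a \<open>j\<close> leaves every finite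
  set as \<open>k\<close> grows, and as \<open>a\<close> vanishes at infinity the damage is at most \<open>\<epsilon>\<close> per integer. This
  is why the error consists of a part \<open>B k\<close> independent of \<open>\<beta>\<close> and a part \<open>B'\<close> independent of \<open>k\<close>.\<close>

lemma fejer_mean_averages:
  assumes \<alpha>: "\<alpha> \<notin> \<rat>" and a1: "\<And>j. norm (a j) \<le> 1"
    and a0: "\<And>\<epsilon>. \<epsilon> > 0 \<Longrightarrow> finite {j. norm (a j) > \<epsilon>}"
  obtains B where "\<And>k. B k \<ge> 0"
    and "\<And>\<beta> \<epsilon>. \<epsilon> > 0 \<Longrightarrow> \<exists>k0 B'. \<forall>k\<ge>k0. \<forall>u v. u \<le> v \<longrightarrow>
     norm ((\<Sum>m=u..<v. fejer_mean a k (real m * \<alpha>) * e (real m * \<beta>))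
        - of_real (real v - real u) * resonant_coeff \<alpha> a \<beta>) \<le> \<epsilon> * (real v - real u) + B k + B'"
proof -
  define J where "J k = {- int k<..<int k}" for k
  define c where "c k j = of_real (1 - \<bar>of_int j\<bar> / real k) * a j" for k j
  have wt: "\<bar>1 - \<bar>of_int j\<bar> / real k\<bar> \<le> 1" if "j \<in> J k" for j k
  proof -
    have "\<bar>real_of_int j\<bar> \<le> real k" using that by (auto simp: J_def)
    then have "\<bar>real_of_int j\<bar> / real k \<le> 1" by (auto simp: divide_le_eq_1)
    then show ?thesis by (simp add: abs_le_iff)
  qed
  have c_le: "norm (c k j) \<le> norm (a j)" if "j \<in> J k" for k j
    unfolding c_def norm_mult norm_of_real using mult_right_mono[OF wt[OF that], of "norm (a j)"] by simp
  have c1: "norm (c k j) \<le> 1" if "j \<in> J k" for k j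
    using c_le[OF that] a1[of j] by linarith
  define isolates where "isolates k b \<beta> i \<longleftrightarrow> (\<forall>j. e (of_int j * \<alpha> + \<beta>) = 1 \<longrightarrow> j \<in> J k \<longrightarrow> i = j) \<and>
     (\<forall>c :: int \<Rightarrow> complex. (\<forall>j\<in>J k. norm (c j) \<le> 1) \<longrightarrow> (\<forall>u v.
       norm (\<Sum>j\<in>J k - {i}. c j * (\<Sum>m=u..<v. e (real m * (of_int j * \<alpha> + \<beta>)))) \<le> b))"
    for k b \<beta> i
  have "\<exists>B. \<forall>k. 0 \<le> B k \<and> (\<forall>\<beta>. \<exists>i. isolates k (B k) \<beta> i)"
    unfolding isolates_def
    by (intro choice allI interval_sum_off_resonance[OF \<alpha>]) (simp add: J_def)
  then obtain B where B0: "\<And>k. 0 \<le> B k" and B: "\<And>k \<beta>. \<exists>i. isolates k (B k) \<beta> i"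
    by blast
  have "\<exists>k0 B'. \<forall>k\<ge>k0. \<forall>u v. u \<le> v \<longrightarrow>
     norm ((\<Sum>m=u..<v. fejer_mean a k (real m * \<alpha>) * e (real m * \<beta>))
        - of_real (real v - real u) * resonant_coeff \<alpha> a \<beta>) \<le> \<epsilon> * (real v - real u) + B k + B'"
    if eps: "\<epsilon> > 0" for \<beta> \<epsilon>
  proof -
    have expand: "(\<Sum>m=u..<v. fejer_mean a k (real m * \<alpha>) * e (real m * \<beta>))
        = (\<Sum>j\<in>J k. c k j * (\<Sum>m=u..<v. e (real m * (of_int j * \<alpha> + \<beta>))))" for k u v
    proof -
      have "(\<Sum>m=u..<v. fejer_mean a k (real m * \<alpha>) * e (real m * \<beta>))
         = (\<Sum>m=u..<v. \<Sum>j\<in>J k. c k j * e (real m * (of_int j * \<alpha> + \<beta>)))"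
        by (simp add: fejer_mean_def J_def c_def sum_distrib_right sum_distrib_left ring_distribs e_add mult_ac)
      also have "\<dots> = (\<Sum>j\<in>J k. c k j * (\<Sum>m=u..<v. e (real m * (of_int j * \<alpha> + \<beta>))))"
        by (subst sum.swap) (simp add: sum_distrib_left)
      finally show ?thesis .
    qed
    \<comment> \<open>The term of the exceptional index, which may lie outside the range of summation.\<close>
    define R where "R k i u v = (if i \<in> J k then c k i * (\<Sum>m=u..<v. e (real m * (of_int i * \<alpha> + \<beta>))) else 0)"
      for k i u v
    have main: "\<exists>i. (\<forall>j. e (of_int j * \<alpha> + \<beta>) = 1 \<longrightarrow> j \<in> J k \<longrightarrow> i = j) \<and> (\<forall>u v.
       norm ((\<Sum>m=u..<v. fejer_mean a k (real m * \<alpha>) * e (real m * \<beta>)) - R k i u v) \<le> B k)" for k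
    proof -
      obtain i where i: "\<forall>j. e (of_int j * \<alpha> + \<beta>) = 1 \<longrightarrow> j \<in> J k \<longrightarrow> i = j"
        and le: "\<And>u v. norm (\<Sum>j\<in>J k - {i}. c k j * (\<Sum>m=u..<v. e (real m * (of_int j * \<alpha> + \<beta>)))) \<le> B k"
        using B[of k \<beta>] c1[of _ k] unfolding isolates_def by blast
      have "(\<Sum>m=u..<v. fejer_mean a k (real m * \<alpha>) * e (real m * \<beta>)) - R k i u v
        = (\<Sum>j\<in>J k - {i}. c k j * (\<Sum>m=u..<v. e (real m * (of_int j * \<alpha> + \<beta>))))" for u v
        unfolding expand R_def by (simp add: J_def sum_diff1)
      then show ?thesis using i le by (intro exI[of _ i]) auto
    qed
    show ?thesis
    proof (cases "\<exists>j. e (of_int j * \<alpha> + \<beta>) = 1")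
      case True
      then obtain j where j: "e (of_int j * \<alpha> + \<beta>) = 1" ..
      obtain k0 :: nat where k0: "\<bar>of_int j\<bar> / \<epsilon> + \<bar>of_int j\<bar> < k0" using reals_Archimedean2 by blast
      show ?thesis
      proof (intro exI[of _ k0] exI[of _ 0] allI impI)
        fix k u v :: nat assume k: "k0 \<le> k" and uv: "u \<le> v"
        have k': "\<bar>real_of_int j\<bar> / \<epsilon> < k" "\<bar>real_of_int j\<bar> < k"
          using k0 k eps by (smt (verit) of_nat_mono divide_nonneg_pos abs_ge_zero)+
        then have jJ: "j \<in> J k" unfolding J_def by auto
        obtain i where i: "\<forall>j. e (of_int j * \<alpha> + \<beta>) = 1 \<longrightarrow> j \<in> J k \<longrightarrow> i = j"
          and le: "norm ((\<Sum>m=u..<v. fejer_mean a k (real m * \<alpha>) * e (real m * \<beta>)) - R k i u v) \<le> B k"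
          using main[of k] by blast
        have "i = j" using i j jJ by blast
        have "R k i u v = of_real (real v - real u) * c k j"
          using jJ uv j by (simp add: R_def \<open>i = j\<close> e_of_nat_mult of_nat_diff mult.commute)
        then have "R k i u v - of_real (real v - real u) * resonant_coeff \<alpha> a \<beta>
          = - of_real ((real v - real u) * (\<bar>of_int j\<bar> / k)) * a j"
          by (simp add: resonant_coeff_eq[OF \<alpha> j] c_def algebra_simps)
        then have "norm (R k i u v - of_real (real v - real u) * resonant_coeff \<alpha> a \<beta>)
           = ((real v - real u) * (\<bar>of_int j\<bar> / k)) * norm (a j)"
          using uv by (simp only: norm_mult norm_minus_cancel norm_of_real) (simp add: abs_mult)
        also have "\<dots> \<le> ((real v - real u) * \<epsilon>) * 1"
        proof (intro mult_mono a1 order.refl)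
          show "\<bar>real_of_int j\<bar> / real k \<le> \<epsilon>"
            using k' eps by (simp add: field_simps)
        qed (use uv eps in auto)
        finally show "norm ((\<Sum>m=u..<v. fejer_mean a k (real m * \<alpha>) * e (real m * \<beta>))
           - of_real (real v - real u) * resonant_coeff \<alpha> a \<beta>) \<le> \<epsilon> * (real v - real u) + B k + 0"
          using le norm_triangle_ineq[of "(\<Sum>m=u..<v. fejer_mean a k (real m * \<alpha>) * e (real m * \<beta>)) - R k i u v"
              "R k i u v - of_real (real v - real u) * resonant_coeff \<alpha> a \<beta>"]
          by (simp add: mult.commute)
      qed
    next
      case False
      define Z where "Z = {j. norm (a j) > \<epsilon>}"
      have Z: "finite Z" unfolding Z_def by (rule a0[OF eps])
      define B' where "B' = (\<Sum>j\<in>Z. 2 / norm (1 - e (of_int j * \<alpha> + \<beta>)))"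
      have B': "B' \<ge> 0" unfolding B'_def by (intro sum_nonneg) auto
      show ?thesis
      proof (intro exI[of _ "0::nat"] exI[of _ B'] allI impI)
        fix k u v :: nat assume uv: "u \<le> v"
        obtain i where le: "norm ((\<Sum>m=u..<v. fejer_mean a k (real m * \<alpha>) * e (real m * \<beta>)) - R k i u v) \<le> B k"
          using main[of k] by blast
        have "norm (R k i u v) \<le> \<epsilon> * (real v - real u) + B'"
        proof (cases "i \<in> J k")
          case iJ: True
          let ?s = "\<Sum>m=u..<v. e (real m * (of_int i * \<alpha> + \<beta>))"
          show ?thesis
          proof (cases "i \<in> Z")
            case True
            have "norm (R k i u v) \<le> 1 * norm ?s"
              using iJ c1 unfolding R_def norm_mult by (simp add: norm_mult mult_left_le_one_le)
            also have "norm ?s \<le> 2 / norm (1 - e (of_int i * \<alpha> + \<beta>))"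
              using norm_sum_e_le[of "of_int i * \<alpha> + \<beta>" u v] False by (simp add: field_simps)
            also have "\<dots> \<le> B'" unfolding B'_def using Z True by (intro member_le_sum) auto
            also have "\<dots> \<le> \<epsilon> * (real v - real u) + B'" using uv eps by simp
            finally show ?thesis by simp
          next
            case False
            have "norm ?s \<le> (\<Sum>m=u..<v. 1)" by (intro sum_norm_le) simp
            then have "norm ?s \<le> real v - real u" using uv by (simp add: of_nat_diff)
            moreover have "norm (c k i) \<le> \<epsilon>" using c_le[OF iJ] False by (simp add: Z_def)
            ultimately have "norm (c k i * ?s) \<le> \<epsilon> * (real v - real u)"
              unfolding norm_mult using eps by (intro mult_mono) auto
            then show ?thesis using B' iJ by (simp add: R_def)
          qed
        next
          case False
          then show ?thesis using B' uv eps by (simp add: R_def)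
        qed
        moreover have "resonant_coeff \<alpha> a \<beta> = 0" using False by (intro resonant_coeff_eq_0) auto
        ultimately show "norm ((\<Sum>m=u..<v. fejer_mean a k (real m * \<alpha>) * e (real m * \<beta>))
           - of_real (real v - real u) * resonant_coeff \<alpha> a \<beta>) \<le> \<epsilon> * (real v - real u) + B k + B'"
          using le norm_triangle_ineq[of "(\<Sum>m=u..<v. fejer_mean a k (real m * \<alpha>) * e (real m * \<beta>)) - R k i u v"
              "R k i u v"] by simp
      qed
    qed
  qed
  then show ?thesis using that[of B] B0 by blast
qed

section \<open>Characters of the circle and weak convergence\<close>

lift_definition circle_char :: "int \<Rightarrow> circle \<Rightarrow> complex" is "\<lambda>j x. e (of_int j * x)"
proof -
  fix j :: int and x y :: real assume "circle_rel x y"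
  then have "of_int j * (x - y) \<in> \<int>" by (intro Ints_mult) (auto simp: circle_rel_def)
  then show "e (of_int j * x) = e (of_int j * y)" by (simp add: e_eq_iff algebra_simps)
qed

lemma circle_char_to_circle [simp]: "circle_char j (to_circle x) = e (of_int j * x)"
  by (rule circle_char.abs_eq)

lemma to_circle_cases [cases type: circle]: obtains x where "y = to_circle x"
  by (rule that[of "rep_circle y"]) (simp add: Quotient_abs_rep[OF Quotient_circle])

lemma circle_char_add: "circle_char (i + j) y = circle_char i y * circle_char j y"
  by (cases y) (simp add: ring_distribs e_add)

lemma circle_char_0 [simp]: "circle_char 0 y = 1"
  by (cases y) simp

lemma cnj_circle_char: "cnj (circle_char j y) = circle_char (- j) y"
  by (cases y) (simp add: cnj_e)

lemma norm_circle_char [simp]: "norm (circle_char j y) = 1"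
  by (cases y) simp

lemma continuous_e: "continuous_on UNIV e"
  unfolding e_def by (intro continuous_intros)

lemma continuous_circle_char: "continuous_on UNIV (circle_char j)"
proof -
  have "continuous_on UNIV (\<lambda>x. e (of_int j * x))"
    by (intro continuous_on_compose2[OF continuous_e] continuous_intros) auto
  then have "open ((\<lambda>x. e (of_int j * x)) -` U)" if "open U" for U
    using that by (simp add: continuous_on_open_vimage)
  then show ?thesis by (auto simp: continuous_on_open_vimage open_circle_def vimage_def)
qed

lemma measurable_circle_char [measurable]: "circle_char j \<in> borel_measurable borel"
  using continuous_circle_char by (rule borel_measurable_continuous_onI)

lemma circle_char_1_eq_iff: "circle_char 1 x = circle_char 1 y \<longleftrightarrow> x = y"
  by (cases x; cases y) (simp add: e_eq_iff to_circle_eq_iff)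

text \<open>The character of index \<open>1\<close> is continuous and injective, so it pulls the Hausdorff property back from the complex plane.
  It is needed for the Stone-Weierstrass theorem.\<close>

instance circle :: t2_space
proof
  fix x y :: circle assume "x \<noteq> y"
  then have "circle_char 1 x \<noteq> circle_char 1 y" by (simp add: circle_char_1_eq_iff)
  then obtain U V where UV: "open U" "open V" "circle_char 1 x \<in> U" "circle_char 1 y \<in> V" "U \<inter> V = {}"
    using hausdorff[of "circle_char 1 x" "circle_char 1 y"] by metis
  have "open (circle_char 1 -` W)" if "open W" for W
    using continuous_circle_char that by (simp add: continuous_on_open_vimage)
  then show "\<exists>U V. open U \<and> open V \<and> x \<in> U \<and> y \<in> V \<and> U \<inter> V = {}"
    using UV by (intro exI[of _ "circle_char 1 -` U"] exI[of _ "circle_char 1 -` V"]) auto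
qed

lemma compact_circle: "compact (UNIV :: circle set)"
proof -
  have "compact (to_circle ` {0..1})"
    by (intro compact_continuous_image continuous_on_subset[OF continuous_to_circle]) auto
  also have "to_circle ` {0..1} = UNIV"
  proof (intro equalityI subsetI)
    fix y :: circle
    obtain x where x: "y = to_circle x" by (cases y)
    have "y = to_circle (frac x)" unfolding x to_circle_eq_iff by (simp add: frac_def)
    then show "y \<in> to_circle ` {0..1}" using frac_ge_0[of x] frac_lt_1[of x] by auto
  qed auto
  finally show ?thesis .
qed

inductive_set trig_polys :: "(circle \<Rightarrow> complex) set" where
  monomial: "(\<lambda>y. a * circle_char j y) \<in> trig_polys"
| add: "p \<in> trig_polys \<Longrightarrow> q \<in> trig_polys \<Longrightarrow> (\<lambda>y. p y + q y) \<in> trig_polys"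

lemma trig_polys_mult:
  assumes "p \<in> trig_polys" "q \<in> trig_polys"
  shows "(\<lambda>y. p y * q y) \<in> trig_polys"
  using assms(1)
proof induction
  case (monomial a i)
  show ?case using assms(2)
  proof induction
    case (monomial b j)
    show ?case using trig_polys.monomial[of "a * b" "i + j"] by (simp add: circle_char_add mult_ac)
  next
    case (add p q)
    then show ?case using trig_polys.add by (fastforce simp: ring_distribs)
  qed
next
  case (add p q)
  then show ?case using trig_polys.add by (fastforce simp: ring_distribs)
qed

lemma trig_polys_continuous: "p \<in> trig_polys \<Longrightarrow> continuous_on UNIV p"
  by (induction rule: trig_polys.induct) (intro continuous_intros continuous_circle_char; simp)+

text \<open>Stone-Weierstrass for the real-valued trigonometric polynomials; the real and the imaginary part of the
  character of index \<open>1\<close> separate points.\<close>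

lemma trig_polys_dense:
  fixes f :: "circle \<Rightarrow> real"
  assumes "continuous_on UNIV f" "\<epsilon> > 0"
  shows "\<exists>g. (\<lambda>y. of_real (g y)) \<in> trig_polys \<and> (\<forall>y. \<bar>f y - g y\<bar> < \<epsilon>)"
proof -
  let ?P = "\<lambda>g :: circle \<Rightarrow> real. (\<lambda>y. complex_of_real (g y)) \<in> trig_polys"
  have re: "?P (\<lambda>y. Re (a * circle_char 1 y))" for a
  proof -
    have "(\<lambda>y. a / 2 * circle_char 1 y + cnj a / 2 * circle_char (-1) y) \<in> trig_polys"
      by (intro trig_polys.intros)
    also have "(\<lambda>y. a / 2 * circle_char 1 y + cnj a / 2 * circle_char (-1) y)
        = (\<lambda>y. of_real (Re (a * circle_char 1 y)))"
    proof
      fix y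
      have half: "of_real (Re z) = (z + cnj z) / 2" for z
        by (simp add: complex_add_cnj)
      show "a / 2 * circle_char 1 y + cnj a / 2 * circle_char (-1) y = of_real (Re (a * circle_char 1 y))"
        unfolding half by (simp add: cnj_circle_char add_divide_distrib)
    qed
    finally show ?thesis .
  qed
  have "\<exists>g. ?P g \<and> (\<forall>x\<in>UNIV. \<bar>f x - g x\<bar> < \<epsilon>)"
  proof (rule Stone_Weierstrass_HOL[OF compact_circle])
    show "?P (\<lambda>y. c)" for c using trig_polys.monomial[of "of_real c" 0] by simp
    show "continuous_on UNIV g" if "?P g" for g
      using continuous_on_Re[OF trig_polys_continuous[OF that]] by simp
    show "?P (\<lambda>y. g y + h y)" if "?P g \<and> ?P h" for g h
      using trig_polys.add[of "\<lambda>y. of_real (g y)" "\<lambda>y. of_real (h y)"] that by simp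
    show "?P (\<lambda>y. g y * h y)" if "?P g \<and> ?P h" for g h
      using trig_polys_mult[of "\<lambda>y. of_real (g y)" "\<lambda>y. of_real (h y)"] that by simp
    show "\<exists>g. ?P g \<and> g x \<noteq> g y" if "x \<in> UNIV \<and> y \<in> UNIV \<and> x \<noteq> y" for x y
    proof -
      have "circle_char 1 x \<noteq> circle_char 1 y" using that by (simp add: circle_char_1_eq_iff)
      then have "Re (1 * circle_char 1 x) \<noteq> Re (1 * circle_char 1 y)
          \<or> Re (- \<i> * circle_char 1 x) \<noteq> Re (- \<i> * circle_char 1 y)"
        by (simp add: complex_eq_iff)
      then show ?thesis by (elim disjE) (intro exI conjI, rule re, assumption)+
    qed
  qed (use assms in auto)
  then show ?thesis by auto
qed

lemma integrable_circle:
  fixes f :: "circle \<Rightarrow> 'b::{banach, second_countable_topology}"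
  assumes "prob_space M" "sets M = sets borel" "continuous_on UNIV f"
  shows "integrable M f"
proof -
  interpret prob_space M by fact
  have "compact (range f)" by (rule compact_continuous_image[OF assms(3) compact_circle])
  then obtain b where "\<And>x. norm (f x) \<le> b"
    by (meson bounded_iff compact_imp_bounded rangeI)
  moreover have "f \<in> borel_measurable M"
    using borel_measurable_continuous_onI[OF assms(3)] measurable_cong_sets[OF assms(2) refl] by blast
  ultimately show ?thesis by (intro integrable_const_bound[of _ b]) auto
qed

text \<open>Weyl's criterion: convergence of the Fourier coefficients carries over to trigonometric
  polynomials by linearity and to continuous functions by density.\<close>

lemma weak_limit_circleI:
  fixes \<nu> :: "circle measure"
  assumes M: "\<forall>\<^sub>F N in sequentially. prob_space (M N) \<and> sets (M N) = sets borel"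
    and \<nu>: "prob_space \<nu>" "sets \<nu> = sets borel"
    and lim: "\<And>j. (\<lambda>N. integral\<^sup>L (M N) (circle_char j)) \<longlonglongrightarrow> integral\<^sup>L \<nu> (circle_char j)"
  shows "weak_limit M \<nu>"
proof -
  have trig: "(\<lambda>N. integral\<^sup>L (M N) p) \<longlonglongrightarrow> integral\<^sup>L \<nu> p" if "p \<in> trig_polys" for p
    using that
  proof induction
    case (monomial a j)
    then show ?case using tendsto_mult_left[OF lim, of a j] by simp
  next
    case (add p q)
    have "\<forall>\<^sub>F N in sequentially. integral\<^sup>L (M N) p + integral\<^sup>L (M N) q = integral\<^sup>L (M N) (\<lambda>y. p y + q y)"
      using M
    proof eventually_elim
      case (elim N)
      then show ?case using add(1,2)[THEN trig_polys_continuous]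
        by (simp add: Bochner_Integration.integral_add integrable_circle)
    qed
    moreover have "integral\<^sup>L \<nu> (\<lambda>y. p y + q y) = integral\<^sup>L \<nu> p + integral\<^sup>L \<nu> q"
      using add(1,2)[THEN trig_polys_continuous] \<nu>
      by (simp add: Bochner_Integration.integral_add integrable_circle)
    ultimately show ?case using tendsto_add[OF add.IH] by (simp add: tendsto_cong)
  qed
  show ?thesis unfolding weak_limit_def
  proof (intro allI impI, elim conjE)
    fix f :: "circle \<Rightarrow> real" assume f: "continuous_on UNIV f"
    show "(\<lambda>N. integral\<^sup>L (M N) f) \<longlonglongrightarrow> integral\<^sup>L \<nu> f"
    proof (rule tendstoI)
      fix \<epsilon> :: real assume eps: "\<epsilon> > 0"
      obtain g where g: "(\<lambda>y. of_real (g y)) \<in> trig_polys" "\<And>y. \<bar>f y - g y\<bar> < \<epsilon> / 3"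
        using trig_polys_dense[OF f, of "\<epsilon> / 3"] eps by auto
      have gc: "continuous_on UNIV g"
        using continuous_on_Re[OF trig_polys_continuous[OF g(1)]] by simp
      have close: "\<bar>integral\<^sup>L P f - integral\<^sup>L P g\<bar> \<le> \<epsilon> / 3"
        if P: "prob_space P" "sets P = sets borel" for P :: "circle measure"
      proof -
        interpret prob_space P by fact
        note int = integrable_circle[OF P f] integrable_circle[OF P gc]
        have "\<bar>integral\<^sup>L P f - integral\<^sup>L P g\<bar> = \<bar>\<integral>y. f y - g y \<partial>P\<bar>"
          using int by simp
        also have "\<dots> \<le> (\<integral>y. \<bar>f y - g y\<bar> \<partial>P)" by (rule integral_abs_bound)
        also have "\<dots> \<le> (\<integral>y. \<epsilon> / 3 \<partial>P)"
          using int g(2) by (intro integral_mono) (auto intro: less_imp_le)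
        finally show ?thesis by (simp add: prob_space)
      qed
      have "(\<lambda>N. of_real (integral\<^sup>L (M N) g) :: complex) \<longlonglongrightarrow> of_real (integral\<^sup>L \<nu> g)"
        using trig[OF g(1)] by simp
      then have "(\<lambda>N. integral\<^sup>L (M N) g) \<longlonglongrightarrow> integral\<^sup>L \<nu> g"
        by (simp add: tendsto_of_real_iff)
      then have "\<forall>\<^sub>F N in sequentially. dist (integral\<^sup>L (M N) g) (integral\<^sup>L \<nu> g) < \<epsilon> / 3"
        using eps by (intro tendstoD) auto
      with M show "\<forall>\<^sub>F N in sequentially. dist (integral\<^sup>L (M N) f) (integral\<^sup>L \<nu> f) < \<epsilon>"
      proof eventually_elim
        case (elim N)
        then have "\<bar>integral\<^sup>L (M N) f - integral\<^sup>L (M N) g\<bar> \<le> \<epsilon> / 3" by (intro close) auto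
        then show ?case using close[OF \<nu>] elim(2) unfolding dist_real_def by linarith
      qed
    qed
  qed
qed

lemma empirical_measure_integral:
  fixes f :: "circle \<Rightarrow> 'b::{banach, second_countable_topology}"
  assumes "f \<in> borel_measurable borel"
  shows "integral\<^sup>L (empirical_measure S \<alpha> N) f
     = (1 / real N) *\<^sub>R (\<Sum>n<N. f (to_circle (real (enumerate S n) * \<alpha>)))"
proof -
  have "(\<lambda>n. to_circle (real (enumerate S n) * \<alpha>)) \<in> uniform_count_measure {..<N} \<rightarrow>\<^sub>M borel"
    by (simp add: measurable_def sets_uniform_count_measure space_uniform_count_measure)
  then have "integral\<^sup>L (empirical_measure S \<alpha> N) f
      = integral\<^sup>L (uniform_count_measure {..<N}) (\<lambda>n. f (to_circle (real (enumerate S n) * \<alpha>)))"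
    unfolding empirical_measure_def using assms by (intro integral_distr)
  then show ?thesis
    by (simp add: uniform_count_measure_def lebesgue_integral_point_measure_finite scaleR_sum_right)
qed

lemma prob_space_empirical_measure:
  assumes "N > 0"
  shows "prob_space (empirical_measure S \<alpha> N)"
  unfolding empirical_measure_def using assms
  by (intro prob_space.prob_space_distr prob_space_uniform_count_measure)
     (auto simp: measurable_def sets_uniform_count_measure space_uniform_count_measure)

section \<open>The Riemann-Lebesgue lemma\<close>

lemma integral_circle_char_lebesgue:
  "integral\<^sup>L lebesgue_circle (circle_char j) = (if j = 0 then 1 else 0)"
proof (cases "j = 0")
  case True
  interpret prob_space lebesgue_circle by (rule prob_space_lebesgue_circle)
  have "circle_char 0 = (\<lambda>_. 1)" by (simp add: fun_eq_iff)
  then show ?thesis using True by (simp add: prob_space)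
next
  case False
  define F where "F x = e (of_int j * x) / (2 * of_real pi * \<i> * of_int j)" for x :: real
  have [measurable]: "e \<in> borel_measurable borel"
    using continuous_e by (rule borel_measurable_continuous_onI)
  have "integral\<^sup>L lebesgue_circle (circle_char j)
      = (\<integral>x. e (of_int j * x) \<partial>uniform_measure lborel {0..<1::real})"
    unfolding lebesgue_circle_def by (subst integral_distr) auto
  also have "\<dots> = (\<integral>x. indicator {0..<1} x *\<^sub>R e (of_int j * x) \<partial>lborel)"
  proof -
    have "uniform_measure lborel {0..<1::real} = density lborel (\<lambda>x. ennreal (indicator {0..<1} x))"
      by (simp add: uniform_measure_def ennreal_indicator divide_ennreal_def)
    then show ?thesis by (simp add: integral_density)
  qed
  also have "\<dots> = (\<integral>x. indicator {0..1} x *\<^sub>R e (of_int j * x) \<partial>lborel)"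
  proof (rule integral_cong_AE)
    show "AE x in lborel. indicator {0..<1} x *\<^sub>R e (of_int j * x) = indicator {0..1::real} x *\<^sub>R e (of_int j * x)"
      using AE_lborel_singleton[of "1::real"] by eventually_elim (auto simp: indicator_def)
  qed auto
  also have "\<dots> = F 1 - F 0"
  proof (rule integral_FTC_atLeastAtMost)
    show "(F has_vector_derivative e (of_int j * x)) (at x within {0..1})" for x
      unfolding F_def e_def using False
      by (auto intro!: derivative_eq_intros has_vector_derivative_real_field simp: field_simps)
    show "continuous_on {0..1} (\<lambda>x. e (of_int j * x))"
      by (intro continuous_on_compose2[OF continuous_e] continuous_intros) auto
  qed simp
  also have "F 1 = F 0"
  proof -
    have "e (of_int j) = 1" by (simp add: e_eq_1_iff)
    then show ?thesis by (simp add: F_def)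
  qed
  finally show ?thesis using False by simp
qed

lemma sets_lebesgue_circle [simp, measurable_cong]: "sets lebesgue_circle = sets borel"
  by (simp add: lebesgue_circle_def)

lemma space_lebesgue_circle [simp]: "space lebesgue_circle = UNIV"
  by (simp add: lebesgue_circle_def)

text \<open>Bessel's inequality: with \<open>h = \<Sum>j\<in>J. cnj (a j) e(j y)\<close>, orthonormality gives
  \<open>\<integral> \<bar>f - h\<bar>\<^sup>2 = \<integral> f\<^sup>2 - \<Sum>j\<in>J. \<bar>a j\<bar>\<^sup>2\<close>, and the left-hand side is nonnegative.\<close>

lemma bessel_circle:
  fixes f :: "circle \<Rightarrow> real"
  assumes f [measurable]: "f \<in> borel_measurable borel" and M: "\<And>y. \<bar>f y\<bar> \<le> M" and J: "finite J"
  shows "(\<Sum>j\<in>J. (norm (\<integral>y. of_real (f y) * circle_char j y \<partial>lebesgue_circle))\<^sup>2) \<le> M\<^sup>2"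
proof -
  interpret prob_space lebesgue_circle by (rule prob_space_lebesgue_circle)
  define a where "a j = (\<integral>y. of_real (f y) * circle_char j y \<partial>lebesgue_circle)" for j
  define s where "s = (\<Sum>j\<in>J. (norm (a j))\<^sup>2)"
  define h where "h y = (\<Sum>j\<in>J. cnj (a j) * circle_char j y)" for y
  have hm: "h \<in> borel_measurable borel" unfolding h_def by measurable
  have hb: "norm (h y) \<le> (\<Sum>j\<in>J. norm (a j))" for y
    unfolding h_def by (intro sum_norm_le) (simp add: norm_mult)
  have hc: "continuous_on UNIV h" unfolding h_def by (intro continuous_intros continuous_circle_char)
  have int_f: "integrable lebesgue_circle (\<lambda>y. of_real (f y) * circle_char j y)" for j
    by (intro integrable_const_bound[of _ M]) (auto simp: norm_mult M)
  have fh: "(\<integral>y. of_real (f y) * h y \<partial>lebesgue_circle) = of_real s"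
  proof -
    have "(\<integral>y. of_real (f y) * h y \<partial>lebesgue_circle)
        = (\<integral>y. (\<Sum>j\<in>J. cnj (a j) * (of_real (f y) * circle_char j y)) \<partial>lebesgue_circle)"
      unfolding h_def by (simp add: sum_distrib_left mult_ac)
    also have "\<dots> = (\<Sum>j\<in>J. cnj (a j) * a j)"
      using int_f by (subst Bochner_Integration.integral_sum) (auto simp: a_def)
    also have "\<dots> = of_real s" unfolding s_def of_real_sum
      by (intro sum.cong refl) (simp add: complex_norm_square mult.commute del: of_real_power)
    finally show ?thesis .
  qed
  have hh: "(\<integral>y. h y * cnj (h y) \<partial>lebesgue_circle) = of_real s"
  proof -
    have int: "integrable lebesgue_circle (\<lambda>y. c * circle_char i y)" for c i
      by (intro integrable_circle prob_space_lebesgue_circle continuous_intros continuous_circle_char) simp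
    have "h y * cnj (h y) = (\<Sum>i\<in>J. \<Sum>j\<in>J. cnj (a i) * a j * circle_char (i - j) y)" for y
    proof -
      have "circle_char (i - j) y = circle_char i y * cnj (circle_char j y)" for i j
        using circle_char_add[of i "- j" y] by (simp add: cnj_circle_char)
      then show ?thesis
        unfolding h_def cnj_sum sum_product by (intro sum.cong refl) (simp add: mult_ac)
    qed
    then have "(\<integral>y. h y * cnj (h y) \<partial>lebesgue_circle)
       = (\<Sum>i\<in>J. \<Sum>j\<in>J. cnj (a i) * a j * (if i = j then 1 else 0))"
      using int by (simp add: Bochner_Integration.integral_sum integral_circle_char_lebesgue)
    also have "\<dots> = (\<Sum>i\<in>J. cnj (a i) * a i)"
      using J by (intro sum.cong refl) (simp add: if_distrib[of "(*) _"] cong: if_cong)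
    also have "\<dots> = of_real s" unfolding s_def of_real_sum
      by (intro sum.cong refl) (simp add: complex_norm_square mult.commute del: of_real_power)
    finally show ?thesis .
  qed
  have i1: "integrable lebesgue_circle (\<lambda>y. (f y)\<^sup>2)"
    using M by (intro integrable_const_bound[of _ "M\<^sup>2"]) (auto simp: abs_le_square_iff[symmetric] intro: order.trans[OF M abs_ge_self])
  have i2: "integrable lebesgue_circle (\<lambda>y. f y * Re (h y))"
  proof -
    have "integrable lebesgue_circle (\<lambda>y. of_real (f y) * h y)"
      using hm hb M by (intro integrable_const_bound[of _ "M * (\<Sum>j\<in>J. norm (a j))"])
        (auto simp: norm_mult intro!: mult_mono order.trans[OF abs_ge_zero M])
    then have "integrable lebesgue_circle (\<lambda>y. Re (of_real (f y) * h y))" by (rule integrable_Re)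
    then show ?thesis by simp
  qed
  have i3: "integrable lebesgue_circle (\<lambda>y. (norm (h y))\<^sup>2)"
    by (intro integrable_circle prob_space_lebesgue_circle continuous_intros hc) simp
  have "0 \<le> (\<integral>y. (norm (of_real (f y) - h y))\<^sup>2 \<partial>lebesgue_circle)"
    by (intro integral_nonneg_AE) simp
  also have "\<dots> = (\<integral>y. (f y)\<^sup>2 - 2 * (f y * Re (h y)) + (norm (h y))\<^sup>2 \<partial>lebesgue_circle)"
    by (simp add: cmod_power2 power2_diff algebra_simps)
  also have "\<dots> = (\<integral>y. (f y)\<^sup>2 \<partial>lebesgue_circle) - 2 * (\<integral>y. f y * Re (h y) \<partial>lebesgue_circle)
       + (\<integral>y. (norm (h y))\<^sup>2 \<partial>lebesgue_circle)"
    using i1 i2 i3 by simp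
  also have "(\<integral>y. f y * Re (h y) \<partial>lebesgue_circle) = s"
  proof -
    have "integrable lebesgue_circle (\<lambda>y. of_real (f y) * h y)"
      using hm hb M by (intro integrable_const_bound[of _ "M * (\<Sum>j\<in>J. norm (a j))"])
        (auto simp: norm_mult intro!: mult_mono order.trans[OF abs_ge_zero M])
    then have "(\<integral>y. Re (of_real (f y) * h y) \<partial>lebesgue_circle) = Re (of_real s)"
      unfolding fh[symmetric] by (rule integral_Re)
    then show ?thesis by simp
  qed
  also have "(\<integral>y. (norm (h y))\<^sup>2 \<partial>lebesgue_circle) = s"
  proof -
    have "of_real (\<integral>y. (norm (h y))\<^sup>2 \<partial>lebesgue_circle) = (\<integral>y. of_real ((norm (h y))\<^sup>2) \<partial>lebesgue_circle :: complex)"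
      by (rule integral_complex_of_real[symmetric])
    also have "\<dots> = of_real s" using hh by (simp only: complex_norm_square)
    finally show ?thesis by (simp only: of_real_eq_iff)
  qed
  also have "(\<integral>y. (f y)\<^sup>2 \<partial>lebesgue_circle) \<le> (\<integral>y. M\<^sup>2 \<partial>lebesgue_circle)"
    using M by (intro integral_mono i1) (auto simp: abs_le_square_iff[symmetric] intro: order.trans[OF M abs_ge_self])
  finally show ?thesis by (simp add: s_def a_def prob_space[unfolded space_lebesgue_circle])
qed

lemma finite_large_coeffs_bounded:
  fixes f :: "circle \<Rightarrow> real"
  assumes f: "f \<in> borel_measurable borel" and M: "\<And>y. \<bar>f y\<bar> \<le> M" and eps: "\<epsilon> > 0"
  shows "finite {j. norm (\<integral>y. of_real (f y) * circle_char j y \<partial>lebesgue_circle) > \<epsilon>}" (is "finite ?Z")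
proof (rule ccontr)
  assume "infinite ?Z"
  obtain n :: nat where n: "M\<^sup>2 / \<epsilon>\<^sup>2 < n" using reals_Archimedean2 by blast
  obtain J where J: "J \<subseteq> ?Z" "finite J" "card J = n"
    using infinite_arbitrarily_large[OF \<open>infinite ?Z\<close>] by blast
  have "n * \<epsilon>\<^sup>2 = (\<Sum>j\<in>J. \<epsilon>\<^sup>2)" using J by simp
  also have "\<dots> \<le> (\<Sum>j\<in>J. (norm (\<integral>y. of_real (f y) * circle_char j y \<partial>lebesgue_circle))\<^sup>2)"
    using J eps by (intro sum_mono power_mono) (auto intro: less_imp_le)
  also have "\<dots> \<le> M\<^sup>2" by (rule bessel_circle[OF f M J(2)])
  finally show False using n eps by (simp add: field_simps)
qed

text \<open>Truncating the density at a large height changes all Fourier coefficients by less than \<open>\<epsilon> / 2\<close>, and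
  Bessel's inequality applies to the bounded density that is left.\<close>

lemma riemann_lebesgue_circle:
  fixes \<nu> :: "circle measure"
  assumes \<nu>: "prob_space \<nu>" "sets \<nu> = sets borel" and ac: "absolutely_continuous lebesgue_circle \<nu>"
    and eps: "\<epsilon> > 0"
  shows "finite {j. norm (integral\<^sup>L \<nu> (circle_char j)) > \<epsilon>}"
proof -
  interpret L: prob_space lebesgue_circle by (rule prob_space_lebesgue_circle)
  interpret N: prob_space \<nu> by (rule \<nu>)
  \<comment> \<open>A Radon-Nikodym density with finite values.\<close>
  obtain D where D [measurable]: "D \<in> borel_measurable lebesgue_circle"
    and dens: "\<nu> = density lebesgue_circle (\<lambda>y. ennreal (D y))" and D0: "\<And>y. 0 \<le> D y"
  proof -
    obtain D0 where D0: "D0 \<in> borel_measurable lebesgue_circle" "density lebesgue_circle D0 = \<nu>"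
      using L.Radon_Nikodym[OF ac] \<nu> by auto
    have "(\<integral>\<^sup>+y. D0 y \<partial>lebesgue_circle) = emeasure \<nu> (space \<nu>)"
      unfolding D0(2)[symmetric] using D0(1) by (subst emeasure_density) (auto intro!: nn_integral_cong)
    then have "(\<integral>\<^sup>+y. D0 y \<partial>lebesgue_circle) \<noteq> \<infinity>" by (simp add: N.emeasure_space_1)
    then have "AE y in lebesgue_circle. D0 y \<noteq> \<infinity>" by (intro nn_integral_PInf_AE D0)
    then have "AE y in lebesgue_circle. D0 y = ennreal (enn2real (D0 y))"
      by eventually_elim (simp add: less_top)
    then have "density lebesgue_circle D0 = density lebesgue_circle (\<lambda>y. ennreal (enn2real (D0 y)))"
      using D0(1) by (intro density_cong) auto
    then show ?thesis using D0 by (intro that[of "\<lambda>y. enn2real (D0 y)"]) auto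
  qed
  have D' [measurable]: "D \<in> borel_measurable borel" using D by simp
  have intD: "integrable lebesgue_circle D"
  proof -
    have "integrable \<nu> (\<lambda>_. 1 :: real)" by simp
    then show ?thesis unfolding dens using D0 by (subst (asm) integrable_density) auto
  qed
  have coeff: "integral\<^sup>L \<nu> (circle_char j) = (\<integral>y. of_real (D y) * circle_char j y \<partial>lebesgue_circle)" for j
    unfolding dens using D0 by (subst integral_density) (auto simp: scaleR_conv_of_real)
  have "(\<lambda>n. \<integral>y. D y - min (D y) (real n) \<partial>lebesgue_circle) \<longlonglongrightarrow> (\<integral>y. 0 \<partial>lebesgue_circle)"
  proof (rule integral_dominated_convergence[where w = D])
    show "AE y in lebesgue_circle. (\<lambda>n. D y - min (D y) (real n)) \<longlonglongrightarrow> 0"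
    proof (rule AE_I2)
      fix y
      obtain m :: nat where "D y < m" using reals_Archimedean2 by blast
      then have "\<forall>\<^sub>F n in sequentially. D y - min (D y) (real n) = 0"
        by (intro eventually_mono[OF eventually_ge_at_top[of m]]) (simp add: min_def)
      then show "(\<lambda>n. D y - min (D y) (real n)) \<longlonglongrightarrow> 0" by (rule tendsto_eventually)
    qed
    show "AE y in lebesgue_circle. norm (D y - min (D y) (real n)) \<le> D y" for n
      using D0 by (intro AE_I2) (simp add: min_def)
  qed (use intD in auto)
  then have "\<forall>\<^sub>F n in sequentially. (\<integral>y. D y - min (D y) (real n) \<partial>lebesgue_circle) < \<epsilon> / 2"
    using eps by (intro order_tendstoD(2)[of _ "\<integral>y. 0 \<partial>lebesgue_circle"]) auto
  then obtain n where n: "(\<integral>y. D y - min (D y) (real n) \<partial>lebesgue_circle) < \<epsilon> / 2"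
    by (auto simp: eventually_sequentially)
  define f where "f y = min (D y) (real n)" for y
  have f [measurable]: "f \<in> borel_measurable borel" unfolding f_def by measurable
  have fb: "\<bar>f y\<bar> \<le> real n" for y using D0[of y] by (simp add: f_def)
  have "norm (integral\<^sup>L \<nu> (circle_char j)) \<le>
      norm (\<integral>y. of_real (f y) * circle_char j y \<partial>lebesgue_circle) + \<epsilon> / 2" for j
  proof -
    have i1: "integrable lebesgue_circle (\<lambda>y. of_real (D y) * circle_char j y)"
      by (rule Bochner_Integration.integrable_bound[OF intD]) (auto simp: norm_mult)
    have i2: "integrable lebesgue_circle (\<lambda>y. of_real (f y) * circle_char j y)"
      by (intro L.integrable_const_bound[of _ "real n"]) (auto simp: norm_mult fb)
    have "integral\<^sup>L \<nu> (circle_char j) - (\<integral>y. of_real (f y) * circle_char j y \<partial>lebesgue_circle)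
       = (\<integral>y. of_real (D y - f y) * circle_char j y \<partial>lebesgue_circle)"
      unfolding coeff using i1 i2 by (simp add: left_diff_distrib)
    also have "norm \<dots> \<le> (\<integral>y. norm (of_real (D y - f y) * circle_char j y) \<partial>lebesgue_circle)"
      by (rule integral_norm_bound)
    also have "\<dots> = (\<integral>y. D y - min (D y) (real n) \<partial>lebesgue_circle)"
      by (intro Bochner_Integration.integral_cong refl) (simp add: norm_mult f_def min_def del: of_real_diff)
    finally have "norm (integral\<^sup>L \<nu> (circle_char j) - (\<integral>y. of_real (f y) * circle_char j y \<partial>lebesgue_circle)) \<le> \<epsilon> / 2"
      using n by simp
    then show ?thesis
      using norm_triangle_sub[of "integral\<^sup>L \<nu> (circle_char j)" "\<integral>y. of_real (f y) * circle_char j y \<partial>lebesgue_circle"]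
      by linarith
  qed
  then have "{j. norm (integral\<^sup>L \<nu> (circle_char j)) > \<epsilon>}
      \<subseteq> {j. norm (\<integral>y. of_real (f y) * circle_char j y \<partial>lebesgue_circle) > \<epsilon> / 2}"
    by (smt (verit, best) Collect_mono field_sum_of_halves)
  then show ?thesis
    by (rule finite_subset) (rule finite_large_coeffs_bounded[OF f fb], use eps in simp)
qed

section \<open>Positivity of the Fejer means of a measure\<close>

text \<open>The diagonal \<open>a - b = j\<close> of the square \<open>{..<k} \<times> {..<k}\<close> has \<open>k - \<bar>j\<bar>\<close> points.\<close>

lemma double_sum_diff:
  fixes g :: "int \<Rightarrow> complex"
  shows "(\<Sum>a<k. \<Sum>b<k. g (int a - int b)) = (\<Sum>j\<in>{- int k<..<int k}. (of_nat k - of_int \<bar>j\<bar>) * g j)"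
proof (induction k)
  case (Suc k)
  have "(\<Sum>a<Suc k. \<Sum>b<Suc k. g (int a - int b)) = (\<Sum>a<k. \<Sum>b<k. g (int a - int b))
     + ((\<Sum>a<k. g (int a - int k)) + (\<Sum>b<k. g (int k - int b)) + g 0)"
    by (simp add: sum.distrib algebra_simps)
  also have "(\<Sum>a<k. g (int a - int k)) = (\<Sum>j\<in>{- int k..<0}. g j)"
    by (rule sum.reindex_bij_witness[of _ "\<lambda>j. nat (j + int k)" "\<lambda>a. int a - int k"]) auto
  also have "(\<Sum>b<k. g (int k - int b)) = (\<Sum>j\<in>{0<..int k}. g j)"
    by (rule sum.reindex_bij_witness[of _ "\<lambda>j. nat (int k - j)" "\<lambda>b. int k - int b"]) auto
  also have "(\<Sum>j\<in>{- int k..<0}. g j) + (\<Sum>j\<in>{0<..int k}. g j) + g 0 = (\<Sum>j\<in>{- int k..int k}. g j)"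
  proof -
    have "{- int k..int k} = insert 0 ({- int k..<0} \<union> {0<..int k})" by auto
    then have "sum g {- int k..int k} = g 0 + sum g ({- int k..<0} \<union> {0<..int k})" by simp
    also have "sum g ({- int k..<0} \<union> {0<..int k}) = sum g {- int k..<0} + sum g {0<..int k}"
      by (rule sum.union_disjoint) auto
    finally show ?thesis by simp
  qed
  also have "(\<Sum>a<k. \<Sum>b<k. g (int a - int b)) = (\<Sum>j\<in>{- int k..int k}. (of_nat k - of_int \<bar>j\<bar>) * g j)"
    unfolding Suc by (rule sum.mono_neutral_left) auto
  also have "(\<Sum>j\<in>{- int k..int k}. (of_nat k - of_int \<bar>j\<bar>) * g j) + (\<Sum>j\<in>{- int k..int k}. g j)
     = (\<Sum>j\<in>{- int k..int k}. (of_nat (Suc k) - of_int \<bar>j\<bar>) * g j)"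
    by (simp add: algebra_simps flip: sum.distrib)
  also have "{- int k..int k} = {- int (Suc k)<..<int (Suc k)}" by auto
  finally show ?case .
qed simp

lemma fejer_kernel_nonneg:
  assumes "k > 0"
  shows "(\<Sum>j\<in>{- int k<..<int k}. of_real (1 - \<bar>of_int j\<bar> / real k) * e (of_int j * t))
     = of_real ((norm (\<Sum>a<k. e (real a * t)))\<^sup>2 / real k)"
proof -
  have abs: "of_int \<bar>j\<bar> = (of_real \<bar>of_int j\<bar> :: complex)" for j
    by (metis of_int_abs of_real_of_int_eq)
  have "of_real ((norm (\<Sum>a<k. e (real a * t)))\<^sup>2) = (\<Sum>a<k. \<Sum>b<k. e (of_int (int a - int b) * t))"
    unfolding complex_norm_square by (simp add: sum_product e_diff left_diff_distrib)
  also have "\<dots> = (\<Sum>j\<in>{- int k<..<int k}. (of_nat k - of_int \<bar>j\<bar>) * e (of_int j * t))"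
    by (rule double_sum_diff)
  also have "\<dots> = of_nat k * (\<Sum>j\<in>{- int k<..<int k}. of_real (1 - \<bar>of_int j\<bar> / real k) * e (of_int j * t))"
    unfolding sum_distrib_left by (intro sum.cong refl) (use assms abs in \<open>simp add: field_simps\<close>)
  finally show ?thesis using assms by (simp add: field_simps del: of_real_power)
qed

text \<open>The Fejer mean is the convolution of \<open>\<nu>\<close> with the Fejer kernel, whose values lie between \<open>0\<close> and \<open>k\<close>.\<close>

lemma fejer_mean_real:
  fixes \<nu> :: "circle measure"
  assumes \<nu>: "prob_space \<nu>" "sets \<nu> = sets borel" and k: "k > 0"
  shows "\<exists>r. 0 \<le> r \<and> r \<le> real k \<and> fejer_mean (\<lambda>j. integral\<^sup>L \<nu> (circle_char (- j))) k x = of_real r"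
proof -
  interpret prob_space \<nu> by fact
  define K where "K y = (\<Sum>j\<in>{- int k<..<int k}. of_real (1 - \<bar>of_int j\<bar> / real k) * e (of_int j * x) * circle_char (- j) y)" for y
  have K: "0 \<le> Re (K y) \<and> Re (K y) \<le> real k \<and> K y = of_real (Re (K y))" for y
  proof -
    obtain t where t: "y = to_circle t" by (cases y)
    let ?r = "(norm (\<Sum>a<k. e (real a * (x - t))))\<^sup>2 / real k"
    have "K y = (\<Sum>j\<in>{- int k<..<int k}. of_real (1 - \<bar>of_int j\<bar> / real k) * e (of_int j * (x - t)))"
      unfolding K_def t by (intro sum.cong refl) (simp add: right_diff_distrib e_diff cnj_e)
    also have "\<dots> = of_real ?r" by (rule fejer_kernel_nonneg[OF k])
    finally have *: "K y = of_real ?r" .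
    have "norm (\<Sum>a<k. e (real a * (x - t))) \<le> (\<Sum>a<k. 1)" by (intro sum_norm_le) simp
    then have "(norm (\<Sum>a<k. e (real a * (x - t))))\<^sup>2 \<le> (real k)\<^sup>2" by (intro power_mono) auto
    then have "?r \<le> real k" using k by (simp add: field_simps power2_eq_square)
    then show ?thesis unfolding * by simp
  qed
  have int: "integrable \<nu> (\<lambda>y. c * circle_char i y)" for c i
    by (intro integrable_circle \<nu> continuous_intros continuous_circle_char)
  have Kc: "integrable \<nu> K" unfolding K_def using int by simp
  have "fejer_mean (\<lambda>j. integral\<^sup>L \<nu> (circle_char (- j))) k x = integral\<^sup>L \<nu> K"
    unfolding K_def fejer_mean_def
    by (subst Bochner_Integration.integral_sum, rule int, intro sum.cong refl) (simp add: mult_ac)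
  also have "\<dots> = (\<integral>y. of_real (Re (K y)) \<partial>\<nu>)" using K by (intro Bochner_Integration.integral_cong) auto
  also have "\<dots> = of_real (\<integral>y. Re (K y) \<partial>\<nu>)" by simp
  finally have "fejer_mean (\<lambda>j. integral\<^sup>L \<nu> (circle_char (- j))) k x = of_real (\<integral>y. Re (K y) \<partial>\<nu>)" .
  moreover have "0 \<le> (\<integral>y. Re (K y) \<partial>\<nu>)" using K by (intro integral_nonneg_AE) auto
  moreover have "(\<integral>y. Re (K y) \<partial>\<nu>) \<le> (\<integral>y. real k \<partial>\<nu>)"
    using K Kc by (intro integral_mono) auto
  ultimately show ?thesis by (auto simp: prob_space)
qed

section \<open>Construction of the representing set\<close>

text \<open>The sign in \<open>a\<close> below makes \<open>a j\<close> the coefficient of \<open>e(j x)\<close> in the Fourier series of \<open>\<nu>\<close>, whereas the limit required at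
  \<open>\<beta> = l \<alpha>\<close> is \<open>\<integral> e(l y) d\<nu>(y)\<close>; the two fit because the resonant index is \<open>- l\<close>.\<close>

lemma representable_if_coeffs_vanish:
  fixes \<nu> :: "circle measure"
  assumes \<nu>: "prob_space \<nu>" "sets \<nu> = sets borel"
    and vanish: "\<And>\<epsilon>. \<epsilon> > 0 \<Longrightarrow> finite {j. norm (integral\<^sup>L \<nu> (circle_char j)) > \<epsilon>}"
    and \<alpha>: "\<alpha> \<notin> \<rat>"
  shows "representable_at \<nu> \<alpha>"
proof -
  interpret prob_space \<nu> by fact
  define a where "a j = integral\<^sup>L \<nu> (circle_char (- j))" for j
  define c where "c = resonant_coeff \<alpha> a"
  have a1: "norm (a j) \<le> 1" for j
  proof -
    have "norm (a j) \<le> (\<integral>y. norm (circle_char (- j) y) \<partial>\<nu>)"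
      unfolding a_def by (rule integral_norm_bound)
    then show ?thesis by (simp add: prob_space)
  qed
  have a0: "finite {j. norm (a j) > \<epsilon>}" if "\<epsilon> > 0" for \<epsilon>
  proof -
    have "{j. norm (a j) > \<epsilon>} = uminus ` {j. norm (integral\<^sup>L \<nu> (circle_char j)) > \<epsilon>}"
      by (force simp: a_def image_iff intro: exI[of _ "- _"])
    then show ?thesis using vanish[OF that] by simp
  qed
  have c_char: "c (of_int l * \<alpha>) = integral\<^sup>L \<nu> (circle_char l)" for l
    unfolding c_def using resonant_coeff_eq[OF \<alpha>, of "- l" "of_int l * \<alpha>" a] by (simp add: a_def)
  have c0: "c 0 = 1"
    using c_char[of 0] circle_char_0[abs_def] by (simp add: prob_space fun_eq_iff[symmetric])
  obtain B0 where B0: "\<And>k. B0 k \<ge> 0" and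
    fejer: "\<And>\<beta> \<epsilon>. \<epsilon> > 0 \<Longrightarrow> \<exists>k0 B'. \<forall>k\<ge>k0. \<forall>u v. u \<le> v \<longrightarrow>
     norm ((\<Sum>m=u..<v. fejer_mean a k (real m * \<alpha>) * e (real m * \<beta>))
        - of_real (real v - real u) * c \<beta>) \<le> \<epsilon> * (real v - real u) + B0 k + B'"
    by (rule fejer_mean_averages[of \<alpha> a, OF \<alpha> a1 a0, folded c_def]) blast+
  have "\<exists>r. \<forall>k m. 0 \<le> r k m \<and> r k m \<le> real (Suc k) \<and> fejer_mean a (Suc k) (real m * \<alpha>) = of_real (r k m)"
    unfolding a_def by (intro choice allI fejer_mean_real[OF \<nu>]) simp
  then obtain r where r: "\<And>k m. 0 \<le> r k m" "\<And>k m. r k m \<le> real (Suc k)"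
     "\<And>k m. fejer_mean a (Suc k) (real m * \<alpha>) = of_real (r k m)" by blast
  \<comment> \<open>Block \<open>k\<close> uses the Fejer mean of order \<open>k + 1\<close>, as there is none of order \<open>0\<close>; dividing by the upper bound
    \<open>k + 1\<close> makes its values probabilities.\<close>
  define d where "d k = 1 / real (Suc k)" for k
  define w where "w k m = d k * r k m" for k m
  have d: "d k > 0" "d k \<le> 1" for k by (simp_all add: d_def)
  have w: "0 \<le> w k m \<and> w k m \<le> 1" for k m using r(1,2)[of k m] by (simp add: w_def d_def)
  \<comment> \<open>The rounding error per integer has to be small compared with the density \<open>d k\<close>
    of the block, hence the accuracy \<open>(d k)\<^sup>2\<close>.\<close>
  have "\<exists>X C. \<forall>\<beta>::real. \<forall>u v. u \<le> v \<longrightarrow>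
      norm (\<Sum>m=u..<v. of_real (of_bool (X m) - w k m) * e (real m * \<beta>)) \<le> (d k)\<^sup>2 * (real v - real u) + C" for k
  proof -
    obtain C where "\<And>w :: nat \<Rightarrow> real. (\<And>j. 0 \<le> w j \<and> w j \<le> 1) \<Longrightarrow>
           (\<exists>x :: nat \<Rightarrow> bool. \<forall>\<beta>::real. \<forall>u v. u \<le> v \<longrightarrow>
              norm (\<Sum>m=u..<v. of_real (of_bool (x m) - w m) * e (real m * \<beta>)) \<le> (d k)\<^sup>2 * (real v - real u) + C)"
      using rounding_intervals[of "(d k)\<^sup>2"] d[of k] by auto
    from this[of "w k", OF w] show ?thesis by blast
  qed
  then have "\<exists>X. \<forall>k. \<exists>C. \<forall>\<beta>::real. \<forall>u v. u \<le> v \<longrightarrow>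
      norm (\<Sum>m=u..<v. of_real (of_bool (X k m) - w k m) * e (real m * \<beta>)) \<le> (d k)\<^sup>2 * (real v - real u) + C"
    by (intro choice allI)
  then obtain X where "\<forall>k. \<exists>C. \<forall>\<beta>::real. \<forall>u v. u \<le> v \<longrightarrow>
      norm (\<Sum>m=u..<v. of_real (of_bool (X k m) - w k m) * e (real m * \<beta>)) \<le> (d k)\<^sup>2 * (real v - real u) + C" ..
  then obtain C where X: "\<And>k \<beta> u v. u \<le> v \<Longrightarrow>
      norm (\<Sum>m=u..<v. of_real (of_bool (X k m) - w k m) * e (real m * \<beta>)) \<le> (d k)\<^sup>2 * (real v - real u) + C k"
    using choice[of "\<lambda>k C. \<forall>\<beta>::real. \<forall>u v. u \<le> v \<longrightarrow>
      norm (\<Sum>m=u..<v. of_real (of_bool (X k m) - w k m) * e (real m * \<beta>)) \<le> (d k)\<^sup>2 * (real v - real u) + C"] by blast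
  have C0: "0 \<le> C k" for k using X[of 0 0 k 0] by simp
  have "\<exists>S. infinite S \<and> 0 \<notin> S \<and>
     (\<forall>\<beta>. (\<lambda>N. (1 / of_nat N) * (\<Sum>n<N. e (real (enumerate S n) * \<beta>))) \<longlonglongrightarrow> c \<beta>)"
  proof (rule glue_blocks[where X = X and d = d and B = "\<lambda>k. B0 (Suc k) + C k"])
    fix \<beta> \<epsilon> :: real assume eps: "\<epsilon> > 0"
    obtain k0 B' where k0: "\<And>k u v. k \<ge> k0 \<Longrightarrow> u \<le> v \<Longrightarrow>
     norm ((\<Sum>m=u..<v. fejer_mean a k (real m * \<alpha>) * e (real m * \<beta>))
        - of_real (real v - real u) * c \<beta>) \<le> \<epsilon> / 2 * (real v - real u) + B0 k + B'"
      using fejer[OF half_gt_zero[OF eps], of \<beta>] by blast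
    obtain k1 :: nat where k1: "2 / \<epsilon> < k1" using reals_Archimedean2 by blast
    show "\<exists>k0 B'. \<forall>k\<ge>k0. \<forall>u v. u \<le> v \<longrightarrow>
       norm ((\<Sum>m=u..<v. of_bool (X k m) * e (real m * \<beta>)) - of_real (d k * (real v - real u)) * c \<beta>)
         \<le> \<epsilon> * (d k * (real v - real u)) + (B0 (Suc k) + C k) + B'"
    proof (intro exI[of _ "max k0 k1"] exI[of _ "max 0 B'"] allI impI)
      fix k u v :: nat assume k: "max k0 k1 \<le> k" and uv: "u \<le> v"
      define n where "n = real v - real u"
      have n: "n \<ge> 0" using uv by (simp add: n_def)
      define F where "F = (\<Sum>m=u..<v. fejer_mean a (Suc k) (real m * \<alpha>) * e (real m * \<beta>))"
      define R where "R = (\<Sum>m=u..<v. of_real (of_bool (X k m) - w k m) * e (real m * \<beta>))"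
      have "(\<Sum>m=u..<v. of_bool (X k m) * e (real m * \<beta>)) = R + of_real (d k) * F"
        unfolding R_def F_def r(3) sum_distrib_left sum.distrib[symmetric]
        by (intro sum.cong refl) (simp add: w_def algebra_simps)
      then have "(\<Sum>m=u..<v. of_bool (X k m) * e (real m * \<beta>)) - of_real (d k * n) * c \<beta>
          = R + of_real (d k) * (F - of_real n * c \<beta>)"
        by (simp add: algebra_simps)
      also have "norm \<dots> \<le> norm R + norm (of_real (d k) * (F - of_real n * c \<beta>))"
        by (rule norm_triangle_ineq)
      also have "norm R \<le> (d k)\<^sup>2 * n + C k" unfolding R_def n_def by (rule X[OF uv])
      also have "norm (of_real (d k) * (F - of_real n * c \<beta>)) = d k * norm (F - of_real n * c \<beta>)"
        using d[of k] by (simp add: norm_mult)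
      also have "\<dots> \<le> d k * (\<epsilon> / 2 * n + B0 (Suc k) + B')"
        unfolding F_def n_def using d[of k] k uv by (intro mult_left_mono k0) auto
      also have "\<dots> \<le> \<epsilon> / 2 * (d k * n) + (B0 (Suc k) + max 0 B')"
      proof -
        have "d k * (B0 (Suc k) + B') \<le> d k * (B0 (Suc k) + max 0 B')"
          using d[of k] by (intro mult_left_mono) auto
        also have "\<dots> \<le> 1 * (B0 (Suc k) + max 0 B')"
          using d[of k] B0[of "Suc k"] by (intro mult_right_mono) auto
        finally have "d k * (B0 (Suc k) + B') \<le> B0 (Suc k) + max 0 B'" by simp
        then show ?thesis by (simp add: algebra_simps)
      qed
      also have "(d k)\<^sup>2 * n \<le> \<epsilon> / 2 * (d k * n)"
      proof -
        have "2 / \<epsilon> \<le> real (Suc k)" using k1 k by simp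
        then have "d k \<le> \<epsilon> / 2" using eps by (simp add: d_def field_simps)
        then have "d k * (d k * n) \<le> \<epsilon> / 2 * (d k * n)" using d[of k] n by (intro mult_right_mono) auto
        then show ?thesis by (simp add: power2_eq_square mult_ac)
      qed
      finally show "norm ((\<Sum>m=u..<v. of_bool (X k m) * e (real m * \<beta>)) - of_real (d k * (real v - real u)) * c \<beta>)
         \<le> \<epsilon> * (d k * (real v - real u)) + (B0 (Suc k) + C k) + max 0 B'"
        by (simp add: n_def)
    qed
  qed (use d B0 C0 c0 in auto)
  then obtain S where S: "infinite S" "0 \<notin> S"
    and lim: "\<And>\<beta>. (\<lambda>N. (1 / of_nat N) * (\<Sum>n<N. e (real (enumerate S n) * \<beta>))) \<longlonglongrightarrow> c \<beta>" by blast
  have "good_set S" unfolding good_set_def using S lim by (auto simp: convergent_def)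
  moreover have "weak_limit (empirical_measure S \<alpha>) \<nu>"
  proof (rule weak_limit_circleI[OF _ \<nu>])
    show "\<forall>\<^sub>F N in sequentially. prob_space (empirical_measure S \<alpha> N) \<and> sets (empirical_measure S \<alpha> N) = sets borel"
      using eventually_gt_at_top[of 0]
      by eventually_elim (simp add: prob_space_empirical_measure, simp add: empirical_measure_def)
    fix j :: int
    show "(\<lambda>N. integral\<^sup>L (empirical_measure S \<alpha> N) (circle_char j)) \<longlonglongrightarrow> integral\<^sup>L \<nu> (circle_char j)"
      using lim[of "of_int j * \<alpha>"] unfolding c_char
      by (simp add: empirical_measure_integral scaleR_conv_of_real mult_ac)
  qed
  ultimately show ?thesis unfolding representable_at_def by blast
qed

theorem mainTheorem4:
  fixes \<nu> :: "circle measure" and \<alpha> :: real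
  assumes "prob_space \<nu>"
    and "sets \<nu> = sets borel"
    and "absolutely_continuous lebesgue_circle \<nu>"
    and "\<alpha> \<notin> \<rat>"
  shows "representable_at \<nu> \<alpha>"
  using representable_if_coeffs_vanish riemann_lebesgue_circle assms by blast

end
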